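(* Let $G=*_C G_i$ ($i\in I$) be an amalgamated free product of groups $G_i$ over a common subgroup $C$. Then no element of $\bigcup_{i\in I}G_i$ is a generalized torsion element of $G$ if and only if for each $i\in I$ there is a family $\mathcal F_i$ of normal subsemigroups of $G_i$ such that: (1) $G_i\setminus\{1\}=\bigcup_{P\in\mathcal F_i}P$ for every $i\in I$; (2) for all $i,j\in I$ and every $P\in\mathcal F_i$ there exists $Q\in\mathcal F_j$ with $P\cap C=Q\cap C$. If, moreover, $C$ is relatively torsion-free in $G_i$ for all $i\in I$ and such families exist, then $G$ is generalized torsion-free.
   Context: A normal subsemigroup of a group $H$ is a (possibly empty) subset closed under multiplication and under conjugation by elements of $H$. An element $g\ne1$ is generalized torsion if $g^{h_1}\cdots g^{h_n}=1$ for some $n\ge1$ and $h_i\in G$, where $g^h=h^{-1}gh$; a group is generalized torsion-free (GTF) if it has none. A subgroup $H\le K$ is relatively torsion-free (RTF) if $gh_1gh_2\cdots gh_k\ne1$ for all $g\in K\setminus H$, $k\ge1$, $h_i\in H$. *)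

theory Defs
  imports "HOL-Algebra.Algebra"
begin

definition list_prod :: "('a, 'b) monoid_scheme \<Rightarrow> 'a list \<Rightarrow> 'a" where
  "list_prod G xs = foldr (\<lambda>x acc. x \<otimes>\<^bsub>G\<^esub> acc) xs \<one>\<^bsub>G\<^esub>"

definition reduced_word :: "'i set \<Rightarrow> ('i \<Rightarrow> 'a set) \<Rightarrow> 'a set \<Rightarrow> ('i \<times> 'a) list \<Rightarrow> bool" where
  "reduced_word I Gi C ws \<longleftrightarrow> ws \<noteq> [] \<and>
     (\<forall>p \<in> set ws. fst p \<in> I \<and> snd p \<in> Gi (fst p) - C) \<and>
     (\<forall>k. Suc k < length ws \<longrightarrow> fst (ws ! k) \<noteq> fst (ws ! Suc k))"

(* G is the (internal) amalgamated free product of its subgroups Gi (i in I) over the common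
   subgroup C: G is generated by the Gi and every reduced word represents a nontrivial element
   (normal form theorem; this characterizes the amalgamated free product up to isomorphism). *)
definition amalgamated_free_product ::
  "('a, 'b) monoid_scheme \<Rightarrow> 'i set \<Rightarrow> ('i \<Rightarrow> 'a set) \<Rightarrow> 'a set \<Rightarrow> bool" where
  "amalgamated_free_product G I Gi C \<longleftrightarrow>
     group G \<and> I \<noteq> {} \<and> subgroup C G \<and>
     (\<forall>i \<in> I. subgroup (Gi i) G \<and> C \<subseteq> Gi i) \<and>
     generate G (\<Union>i \<in> I. Gi i) = carrier G \<and>
     (\<forall>ws. reduced_word I Gi C ws \<longrightarrow> list_prod G (map snd ws) \<noteq> \<one>\<^bsub>G\<^esub>)"

(* normal subsemigroup of the group with carrier H (inside G): closed under multiplication and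
   conjugation by elements of H; possibly empty *)
definition normal_subsemigroup :: "('a, 'b) monoid_scheme \<Rightarrow> 'a set \<Rightarrow> 'a set \<Rightarrow> bool" where
  "normal_subsemigroup G H P \<longleftrightarrow> P \<subseteq> H \<and>
     (\<forall>x \<in> P. \<forall>y \<in> P. x \<otimes>\<^bsub>G\<^esub> y \<in> P) \<and>
     (\<forall>x \<in> P. \<forall>h \<in> H. inv\<^bsub>G\<^esub> h \<otimes>\<^bsub>G\<^esub> x \<otimes>\<^bsub>G\<^esub> h \<in> P)"

definition conj_by :: "('a, 'b) monoid_scheme \<Rightarrow> 'a \<Rightarrow> 'a \<Rightarrow> 'a" where
  "conj_by G g h = inv\<^bsub>G\<^esub> h \<otimes>\<^bsub>G\<^esub> g \<otimes>\<^bsub>G\<^esub> h"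

definition generalized_torsion :: "('a, 'b) monoid_scheme \<Rightarrow> 'a \<Rightarrow> bool" where
  "generalized_torsion G g \<longleftrightarrow> g \<in> carrier G \<and> g \<noteq> \<one>\<^bsub>G\<^esub> \<and>
     (\<exists>hs. hs \<noteq> [] \<and> set hs \<subseteq> carrier G \<and> list_prod G (map (conj_by G g) hs) = \<one>\<^bsub>G\<^esub>)"

definition generalized_torsion_free :: "('a, 'b) monoid_scheme \<Rightarrow> bool" where
  "generalized_torsion_free G \<longleftrightarrow> (\<forall>g \<in> carrier G. \<not> generalized_torsion G g)"

definition relatively_torsion_free :: "('a, 'b) monoid_scheme \<Rightarrow> 'a set \<Rightarrow> 'a set \<Rightarrow> bool" where
  "relatively_torsion_free G H K \<longleftrightarrow>
     (\<forall>g \<in> K - H. \<forall>hs. hs \<noteq> [] \<and> set hs \<subseteq> H \<longrightarrow>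
        list_prod G (map (\<lambda>h. g \<otimes>\<^bsub>G\<^esub> h) hs) \<noteq> \<one>\<^bsub>G\<^esub>)"

end

(*
Both parts show that a product of elements of a conjugation invariant subset S of G is never 1. Let
G act on the Bass-Serre tree with base vertex b. Nielsen's method works if two elements of S can be
merged into one element of S as soon as they overlap in a common piece of tree, since otherwise the
longer one of two elements with too much cancellation is shortened by conjugation, or the two can
be swapped.

For the first part S consists of the conjugates of the members of a compatible choice of normal
subsemigroups Q_i; these are elliptic, and elements with a common fixed vertex can be merged.

For the second part let g = w_0 ... w_(m-1) be cyclically reduced of length m > 1. Products of
elements tagged by the positions 0, ..., m-1, the tag k standing for the double coset C w_k C, are
closed walks on Z/m. Lift each step to an integer in [2-m, 1]. Then S consists of the conjugates of
the walks that go up in total. A concatenation of two such walks goes up again, and relative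
torsion-freeness says that a subproduct of one type lying in C is not constantly tagged, so that it
can be cut out of a walk without making it go up less. Hence the elements of S are hyperbolic, and
they can be merged if their axes share a coset of C.
*)
theory Submission
  imports Defs
begin

section \<open>Length functions and Nielsen's method\<close>

text \<open>The tree itself is never built: \<open>L\<close> is half the displacement of the base
  vertex, and the four-point inequality \<open>L_hyperbolic\<close> is all that Nielsen's method
  takes from it. The conjugates of \<open>g\<close> alone would not do as \<open>S\<close>, since
  two that overlap need not multiply to a third; hence the enlargement to a set that is a semigroup
  at each coset of \<open>C\<close>. The bound on the lift serves two purposes. Reading the word
  itself rises by one at every step, a full turn, so \<open>g\<close> is a positive walk. And
  neighbouring letters, also across the end, lie in different factors, so a stretch inside one
  factor never rises: it is level only if its tags are constant, which relative torsion-freeness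
  excludes for a product in \<open>C\<close>, and otherwise its fall pays for the jump over the gap.
  The delicate point of the geometry is that an axis may come closest to the base vertex at a coset
  of a factor instead of a coset of \<open>C\<close>; the parameter \<open>\<eta>\<close> separates
  the two cases.\<close>

context group
begin

lemma inv_mult_cancel [simp]:
  "\<lbrakk>x \<in> carrier G; y \<in> carrier G\<rbrakk> \<Longrightarrow> inv x \<otimes> (x \<otimes> y) = y"
  "\<lbrakk>x \<in> carrier G; y \<in> carrier G\<rbrakk> \<Longrightarrow> x \<otimes> (inv x \<otimes> y) = y"
  by (simp_all flip: m_assoc)

lemma list_prod_Nil [simp]: "list_prod G [] = \<one>"
  by (simp add: list_prod_def)

lemma list_prod_Cons [simp]: "list_prod G (x # xs) = x \<otimes> list_prod G xs"
  by (simp add: list_prod_def)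

lemma list_prod_closed [simp]: "set xs \<subseteq> carrier G \<Longrightarrow> list_prod G xs \<in> carrier G"
  by (induction xs) auto

lemma list_prod_append:
  "\<lbrakk>set xs \<subseteq> carrier G; set ys \<subseteq> carrier G\<rbrakk> \<Longrightarrow>
    list_prod G (xs @ ys) = list_prod G xs \<otimes> list_prod G ys"
  by (induction xs) (auto simp: m_assoc)

lemma list_prod_in_subgroup:
  "\<lbrakk>subgroup H G; set xs \<subseteq> H\<rbrakk> \<Longrightarrow> list_prod G xs \<in> H"
  by (induction xs) (auto intro: subgroup.one_closed subgroup.m_closed)

lemma list_prod_conj:
  "\<lbrakk>set xs \<subseteq> carrier G; x \<in> carrier G\<rbrakk> \<Longrightarrow>
    list_prod G (map (\<lambda>y. x \<otimes> y \<otimes> inv x) xs) = x \<otimes> list_prod G xs \<otimes> inv x"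
  by (induction xs) (auto simp: m_assoc)

end

text \<open>A Lyndon length function; \<open>L_hyperbolic\<close> is the four-point condition of a
  tree, seen from the base vertex.\<close>

locale length_function = group G for G :: "('a, 'b) monoid_scheme" (structure) +
  fixes L :: "'a \<Rightarrow> nat"
  assumes L_one: "L \<one> = 0"
    and L_inv: "x \<in> carrier G \<Longrightarrow> L (inv x) = L x"
    and L_triangle: "\<lbrakk>x \<in> carrier G; y \<in> carrier G\<rbrakk> \<Longrightarrow> L (x \<otimes> y) \<le> L x + L y"
    and L_hyperbolic: "\<lbrakk>x \<in> carrier G; y \<in> carrier G; z \<in> carrier G\<rbrakk> \<Longrightarrow>
      min (int (L x) + int (L y) - int (L (inv x \<otimes> y)))
          (int (L y) + int (L z) - int (L (inv y \<otimes> z)))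
        \<le> int (L x) + int (L z) - int (L (inv x \<otimes> z))"
begin

text \<open>If \<open>G\<close> acts on a tree and \<open>L x\<close> is half the displacement of a base vertex \<open>b\<close>, then
  \<open>gp x y\<close> is the length of the common initial part of the geodesics from \<open>b\<close> to
  \<open>x b\<close> and to \<open>y b\<close>.\<close>

definition gp :: "'a \<Rightarrow> 'a \<Rightarrow> int" where
  "gp x y = int (L x) + int (L y) - int (L (inv x \<otimes> y))"

lemma gp_hyperbolic:
  "\<lbrakk>x \<in> carrier G; y \<in> carrier G; z \<in> carrier G\<rbrakk> \<Longrightarrow> min (gp x y) (gp y z) \<le> gp x z"
  using L_hyperbolic by (simp add: gp_def)

lemma L_inv_mult_commute:
  "\<lbrakk>x \<in> carrier G; y \<in> carrier G\<rbrakk> \<Longrightarrow> L (inv x \<otimes> y) = L (inv y \<otimes> x)"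
  using L_inv[of "inv x \<otimes> y"] by (simp add: inv_mult_group)

lemma gp_commute: "\<lbrakk>x \<in> carrier G; y \<in> carrier G\<rbrakk> \<Longrightarrow> gp x y = gp y x"
  by (simp add: gp_def L_inv_mult_commute)

lemma gp_le_left: "\<lbrakk>x \<in> carrier G; y \<in> carrier G\<rbrakk> \<Longrightarrow> gp x y \<le> 2 * int (L x)"
  using L_triangle[of x "inv x \<otimes> y"] by (simp add: gp_def)

lemma L_mult: "\<lbrakk>x \<in> carrier G; y \<in> carrier G\<rbrakk> \<Longrightarrow>
    int (L (x \<otimes> y)) = int (L x) + int (L y) - gp (inv x) y"
  by (simp add: gp_def L_inv)

lemma gp_mult: "\<lbrakk>x \<in> carrier G; y \<in> carrier G\<rbrakk> \<Longrightarrow>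
    gp x (x \<otimes> y) = 2 * int (L x) - gp (inv x) y"
  by (simp add: gp_def L_inv)

lemma L_conj_le: "\<lbrakk>x \<in> carrier G; y \<in> carrier G\<rbrakk> \<Longrightarrow> L (x \<otimes> y \<otimes> inv x) \<le> 2 * L x + L y"
  using L_triangle[of x y] L_triangle[of "x \<otimes> y" "inv x"] L_inv[of x] by simp

text \<open>Little cancellation between neighbours forces the product to be nontrivial: the geodesic to the
  product follows the one to the first factor beyond its midpoint.\<close>

lemma list_prod_little_cancellation:
  assumes "set (e # es) \<subseteq> carrier G" "es \<noteq> []"
    and "successively (\<lambda>x y. gp (inv x) y < L x \<and> gp (inv x) y \<le> L y) (e # es)"
  shows "gp e (list_prod G (e # es)) > L e"
  using assms
proof (induction es arbitrary: e)
  case Nil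
  then show ?case by simp
next
  case (Cons f fs)
  have in_G: "e \<in> carrier G" "f \<in> carrier G" "set fs \<subseteq> carrier G"
    using Cons.prems by auto
  have c: "gp (inv e) f < L e" "gp (inv e) f \<le> L f"
    using Cons.prems by auto
  have "gp (inv e) (list_prod G (f # fs)) < L e"
  proof (cases "fs = []")
    case True
    then show ?thesis using c in_G by simp
  next
    case False
    then have "gp f (list_prod G (f # fs)) > L f"
      using Cons.IH[of f] Cons.prems by simp
    \<comment> \<open>The strict bound for the tail exceeds \<open>gp (inv e) f \<le> L f\<close>,
      so in the four-point inequality the first term of the minimum must be the small one.\<close>
    moreover have "min (gp (inv e) (list_prod G (f # fs))) (gp (list_prod G (f # fs)) f) \<le> gp (inv e) f"
      using in_G by (intro gp_hyperbolic) auto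
    moreover have "gp (list_prod G (f # fs)) f = gp f (list_prod G (f # fs))"
      using in_G by (intro gp_commute) auto
    ultimately show ?thesis
      using c by linarith
  qed
  then show ?case
    using in_G gp_mult[of e "list_prod G (f # fs)"] by simp
qed

text \<open>This is the sum of \<open>i * L (xs ! i)\<close>, positions counted from 0, so moving a
  longer factor to the left lowers it.\<close>

fun weight :: "'a list \<Rightarrow> nat" where
  "weight [] = 0"
| "weight (x # xs) = weight xs + sum_list (map L xs)"

lemma weight_append: "weight (xs @ ys) = weight xs + weight ys + length xs * sum_list (map L ys)"
  by (induction xs) auto

lemma not_successivelyE:
  assumes "\<not> successively P xs"
  obtains as x y bs where "xs = as @ [x, y] @ bs" "\<not> P x y"
proof -
  obtain i where i: "Suc i < length xs" "\<not> P (xs ! i) (xs ! Suc i)"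
    using assms by (auto simp: successively_conv_nth)
  have "xs = take i xs @ drop i xs" by simp
  also have "drop i xs = xs ! i # xs ! Suc i # drop (Suc (Suc i)) xs"
    using i by (simp add: Cons_nth_drop_Suc)
  finally show thesis using i that by simp
qed

text \<open>Nielsen's method. Among all factorizations of a product over \<open>S\<close> pick one with fewest factors,
  then least total length, then short factors as far to the right as possible. The
  alternatives for two overlapping neighbours \<open>e f\<close>, to merge them or to replace them by
  \<open>(e f inv e) e\<close> or \<open>f (inv f e f)\<close>, are then all excluded.\<close>

theorem list_prod_neq_one_Nielsen:
  assumes S: "S \<subseteq> carrier G" "\<one> \<notin> S"
    and conj: "\<And>e f. \<lbrakk>e \<in> S; f \<in> S\<rbrakk> \<Longrightarrow> e \<otimes> f \<otimes> inv e \<in> S \<and> inv f \<otimes> e \<otimes> f \<in> S"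
    and left: "\<And>e f. \<lbrakk>e \<in> S; f \<in> S; L e \<le> L f; gp (inv e) f \<ge> L e\<rbrakk> \<Longrightarrow> e \<otimes> f \<in> S \<or>
      L e < L f \<and> L (e \<otimes> f \<otimes> inv e) \<le> L f"
    and right: "\<And>e f. \<lbrakk>e \<in> S; f \<in> S; L f \<le> L e; gp (inv e) f > L f\<rbrakk> \<Longrightarrow> e \<otimes> f \<in> S \<or>
      L (inv f \<otimes> e \<otimes> f) < L e"
  shows "\<lbrakk>set es \<subseteq> S; es \<noteq> []\<rbrakk> \<Longrightarrow> list_prod G es \<noteq> \<one>"
proof (induction es rule: wf_induct_rule[OF wf_measures[of "[length, \<lambda>xs. sum_list (map L xs), weight]"]])
  case (1 es)
  show ?case
  proof (cases "successively (\<lambda>x y. gp (inv x) y < L x \<and> gp (inv x) y \<le> L y) es")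
    case True
    obtain e fs where es: "es = e # fs" using 1 by (cases es) auto
    show ?thesis
    proof (cases "fs = []")
      case True
      then show ?thesis using 1 es S by auto
    next
      case False
      have in_G: "set es \<subseteq> carrier G" using 1 S by blast
      have "gp e (list_prod G es) > L e"
        using list_prod_little_cancellation[of e fs] in_G True False es by blast
      moreover have "gp e \<one> = 0"
        using in_G es L_one L_inv by (simp add: gp_def)
      ultimately show ?thesis by auto
    qed
  next
    case False
    then obtain as e f bs where es: "es = as @ [e, f] @ bs"
      and bad: "\<not> (gp (inv e) f < L e \<and> gp (inv e) f \<le> L f)"
      by (rule not_successivelyE)
    have in_S: "e \<in> S" "f \<in> S" "set as \<subseteq> S" "set bs \<subseteq> S"
      using 1 es by auto
    have in_G: "e \<in> carrier G" "f \<in> carrier G" "set as \<subseteq> carrier G" "set bs \<subseteq> carrier G"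
      using in_S S by auto
    have smaller: ?thesis
      if "(as @ xs @ bs, es) \<in> measures [length, \<lambda>xs. sum_list (map L xs), weight]"
        "set xs \<subseteq> S" "xs \<noteq> []" "list_prod G xs = e \<otimes> f" for xs
    proof -
      have xs: "set xs \<subseteq> carrier G" using that S by auto
      have "list_prod G (as @ xs @ bs) = list_prod G es"
        using in_G that(4) xs by (simp add: es list_prod_append m_assoc)
      moreover have "list_prod G (as @ xs @ bs) \<noteq> \<one>"
        using that in_S by (intro 1) auto
      ultimately show ?thesis by simp
    qed
    have merge: ?thesis if "e \<otimes> f \<in> S"
      using that in_G by (intro smaller[of "[e \<otimes> f]"]) (auto simp: es)
    \<comment> \<open>If the total length does not drop, the new first factor is as long as
      \<open>f\<close>, and the weight drops because the longer factor moved left.\<close>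
    have swap_left: ?thesis
      if "L e < L f" "L (e \<otimes> f \<otimes> inv e) \<le> L f"
      using that in_G in_S conj[OF in_S(1,2)]
      by (intro smaller[of "[e \<otimes> f \<otimes> inv e, e]"])
        (auto simp: es weight_append m_assoc le_less algebra_simps)
    have swap_right: ?thesis
      if "L (inv f \<otimes> e \<otimes> f) < L e"
      using that in_G in_S conj[OF in_S(1,2)]
      by (intro smaller[of "[f, inv f \<otimes> e \<otimes> f]"]) (auto simp: es m_assoc)
    \<comment> \<open>Too much cancellation on either side also exceeds the bound for the shorter
      factor, so comparing lengths leaves two cases.\<close>
    consider "L e \<le> L f" "gp (inv e) f \<ge> L e" | "L f \<le> L e" "gp (inv e) f > L f"
      using bad by linarith
    then show ?thesis
    proof cases
      case 1
      then show ?thesis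
        using left[of e f] in_S merge swap_left by blast
    next
      case 2
      then show ?thesis
        using right[of e f] in_S merge swap_right by blast
    qed
  qed
qed

end

section \<open>The length function of an amalgamated product\<close>

fun lcp_length :: "'c list \<Rightarrow> 'c list \<Rightarrow> nat" where
  "lcp_length (x # xs) (y # ys) = (if x = y then Suc (lcp_length xs ys) else 0)"
| "lcp_length _ _ = 0"

lemma lcp_length_le: "lcp_length xs ys \<le> length xs" "lcp_length xs ys \<le> length ys"
  by (induction xs ys rule: lcp_length.induct) auto

lemma lcp_length_ultrametric:
  "min (lcp_length xs ys) (lcp_length ys zs) \<le> lcp_length xs zs"
proof (induction xs ys arbitrary: zs rule: lcp_length.induct)
  case (1 x xs y ys)
  then show ?case by (cases zs) (auto simp: min_le_iff_disj)
qed auto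

locale amalgam = group G for G :: "('a, 'b) monoid_scheme" (structure) +
  fixes I :: "'i set" and Gi :: "'i \<Rightarrow> 'a set" and C :: "'a set"
  assumes amalgamated: "amalgamated_free_product G I Gi C"
begin

lemma subgroup_C: "subgroup C G"
  and subgroup_Gi: "i \<in> I \<Longrightarrow> subgroup (Gi i) G"
  and C_subset_Gi: "i \<in> I \<Longrightarrow> C \<subseteq> Gi i"
  and generate_Gi: "generate G (\<Union>i\<in>I. Gi i) = carrier G"
  and reduced_word_neq_one: "reduced_word I Gi C ws \<Longrightarrow> list_prod G (map snd ws) \<noteq> \<one>"
  using amalgamated by (auto simp: amalgamated_free_product_def)

lemma C_closed [simp]:
  "\<one> \<in> C"
  "c \<in> C \<Longrightarrow> c \<in> carrier G"
  "c \<in> C \<Longrightarrow> inv c \<in> C"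
  "\<lbrakk>c \<in> C; d \<in> C\<rbrakk> \<Longrightarrow> c \<otimes> d \<in> C"
  using subgroup_C
  by (auto simp: subgroup.one_closed subgroup.m_inv_closed subgroup.m_closed dest: subgroup.mem_carrier)

lemma Gi_closed:
  assumes "i \<in> I"
  shows "a \<in> Gi i \<Longrightarrow> a \<in> carrier G"
    and "a \<in> Gi i \<Longrightarrow> inv a \<in> Gi i"
    and "\<lbrakk>a \<in> Gi i; b \<in> Gi i\<rbrakk> \<Longrightarrow> a \<otimes> b \<in> Gi i"
    and "c \<in> C \<Longrightarrow> c \<in> Gi i"
    and "\<one> \<in> Gi i"
  using subgroup_Gi[OF assms] C_subset_Gi[OF assms]
  by (auto simp: subgroup.m_inv_closed subgroup.m_closed subgroup.one_closed dest: subgroup.mem_carrier)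

lemma C_mult_iff:
  assumes "c \<in> C" "x \<in> carrier G"
  shows "c \<otimes> x \<in> C \<longleftrightarrow> x \<in> C" and "x \<otimes> c \<in> C \<longleftrightarrow> x \<in> C"
proof -
  show "c \<otimes> x \<in> C \<longleftrightarrow> x \<in> C"
    using C_closed(4)[of "inv c" "c \<otimes> x"] assms by auto
  have "x = x \<otimes> c \<otimes> inv c" using assms by (simp add: m_assoc)
  then show "x \<otimes> c \<in> C \<longleftrightarrow> x \<in> C"
    using C_closed(4)[of "x \<otimes> c" "inv c"] assms by auto
qed

lemma inv_in_C_iff: "x \<in> carrier G \<Longrightarrow> inv x \<in> C \<longleftrightarrow> x \<in> C"
  using C_closed(3)[of x] C_closed(3)[of "inv x"] by auto

section \<open>Reduced words and the elements they represent\<close>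

definition letter :: "'i \<times> 'a \<Rightarrow> bool" where
  "letter p \<longleftrightarrow> fst p \<in> I \<and> snd p \<in> Gi (fst p) - C"

definition word :: "('i \<times> 'a) list \<Rightarrow> bool" where
  "word ws \<longleftrightarrow> (\<forall>p \<in> set ws. letter p) \<and> distinct_adj (map fst ws)"

abbreviation val :: "('i \<times> 'a) list \<Rightarrow> 'a" where
  "val ws \<equiv> list_prod G (map snd ws)"

lemma word_iff: "word ws \<longleftrightarrow> ws = [] \<or> reduced_word I Gi C ws"
  by (auto simp: word_def reduced_word_def letter_def distinct_adj_conv_nth)

lemma letter_closed: "letter p \<Longrightarrow> snd p \<in> carrier G"
  using Gi_closed(1) by (auto simp: letter_def)

lemma letter_inv: "letter (i, a) \<Longrightarrow> letter (i, inv a)"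
  using Gi_closed(1,2)[of i a] by (auto simp: letter_def inv_in_C_iff)

lemma letter_mult_left: "\<lbrakk>letter (i, a); c \<in> C\<rbrakk> \<Longrightarrow> letter (i, c \<otimes> a)"
  and letter_mult_right: "\<lbrakk>letter (i, a); c \<in> C\<rbrakk> \<Longrightarrow> letter (i, a \<otimes> c)"
  by (auto simp: letter_def C_mult_iff Gi_closed)

lemma word_letters_closed: "word ws \<Longrightarrow> set (map snd ws) \<subseteq> carrier G"
  using letter_closed by (auto simp: word_def)

lemma val_closed [simp]: "word ws \<Longrightarrow> val ws \<in> carrier G"
  using word_letters_closed by (intro list_prod_closed) auto

lemma word_Nil [simp]: "word []"
  by (simp add: word_def)

lemma word_Cons: "word (p # ws) \<longleftrightarrow> letter p \<and> word ws \<and> (ws = [] \<or> fst p \<noteq> fst (hd ws))"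
  by (auto simp: word_def distinct_adj_Cons hd_map)

lemma word_append:
  "word (us @ vs) \<longleftrightarrow> word us \<and> word vs \<and> (us = [] \<or> vs = [] \<or> fst (last us) \<noteq> fst (hd vs))"
  by (auto simp: word_def distinct_adj_append_iff hd_map last_map)

lemma val_append: "\<lbrakk>word us; word vs\<rbrakk> \<Longrightarrow> val (us @ vs) = val us \<otimes> val vs"
  using word_letters_closed by (simp add: list_prod_append)

definition inv_word :: "('i \<times> 'a) list \<Rightarrow> ('i \<times> 'a) list" where
  "inv_word ws = rev (map (\<lambda>(i, a). (i, inv a)) ws)"

lemma inv_word_simps [simp]:
  "inv_word [] = []" "inv_word (p # ws) = inv_word ws @ [(fst p, inv (snd p))]"
  "length (inv_word ws) = length ws" "inv_word ws = [] \<longleftrightarrow> ws = []"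
  by (auto simp: inv_word_def split_beta)

lemma inv_word_append: "inv_word (us @ vs) = inv_word vs @ inv_word us"
  by (simp add: inv_word_def)

lemma hd_inv_word: "ws \<noteq> [] \<Longrightarrow> fst (hd (inv_word ws)) = fst (last ws)"
  by (cases ws rule: rev_cases) (auto simp: inv_word_append)

lemma last_inv_word: "ws \<noteq> [] \<Longrightarrow> fst (last (inv_word ws)) = fst (hd ws)"
  by (cases ws) auto

lemma word_inv_word [simp]: "word ws \<Longrightarrow> word (inv_word ws)"
  by (induction ws) (auto simp: word_Cons word_append last_inv_word letter_inv)

lemma val_inv_word: "word ws \<Longrightarrow> val (inv_word ws) = inv (val ws)"
proof (induction ws)
  case (Cons p ws)
  then have "letter p" "word ws" by (auto simp: word_Cons)
  with Cons show ?case
    by (simp add: list_prod_append inv_mult_group letter_closed word_letters_closed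
        del: set_map)
qed auto

text \<open>On the empty word the factor \<open>c\<close> is dropped; \<open>represents\<close>
  recovers it in its trailing factor.\<close>

fun mult_word :: "'a \<Rightarrow> ('i \<times> 'a) list \<Rightarrow> ('i \<times> 'a) list" where
  "mult_word c [] = []"
| "mult_word c ((i, a) # ws) = (i, c \<otimes> a) # ws"

lemma length_mult_word [simp]: "length (mult_word c ws) = length ws"
  and map_fst_mult_word [simp]: "map fst (mult_word c ws) = map fst ws"
  by (cases "(c, ws)" rule: mult_word.cases; simp)+

lemma word_mult_word: "\<lbrakk>word ws; c \<in> C\<rbrakk> \<Longrightarrow> word (mult_word c ws)"
  by (cases "(c, ws)" rule: mult_word.cases) (auto simp: word_Cons letter_mult_left)

lemma val_mult_word: "\<lbrakk>word ws; c \<in> C; ws \<noteq> []\<rbrakk> \<Longrightarrow> val (mult_word c ws) = c \<otimes> val ws"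
  by (cases "(c, ws)" rule: mult_word.cases)
    (auto simp: word_Cons m_assoc dest: letter_closed)

text \<open>The trailing factor from \<open>C\<close> lets the empty word stand for all of
  \<open>C\<close>, so a word describes a vertex (a coset of \<open>C\<close>) rather than an
  element.\<close>

definition represents :: "('i \<times> 'a) list \<Rightarrow> 'a \<Rightarrow> bool" where
  "represents ws x \<longleftrightarrow> word ws \<and> (\<exists>c\<in>C. x = val ws \<otimes> c)"

lemma represents_closed: "represents ws x \<Longrightarrow> x \<in> carrier G"
  by (auto simp: represents_def)

lemma represents_val: "word ws \<Longrightarrow> represents ws (val ws)"
  by (auto simp: represents_def intro!: bexI[of _ \<one>])

lemma represents_Nil: "represents [] \<one>"
  using represents_val[of "[]"] by simp

lemma represents_mult_right: "\<lbrakk>represents ws x; c \<in> C\<rbrakk> \<Longrightarrow> represents ws (x \<otimes> c)"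
  by (auto simp: represents_def m_assoc)

lemma represents_mult_left: "\<lbrakk>represents ws x; c \<in> C\<rbrakk> \<Longrightarrow> represents (mult_word c ws) (c \<otimes> x)"
  by (cases "ws = []") (auto simp: represents_def val_mult_word word_mult_word m_assoc)

text \<open>A value in \<open>C\<close> could be cancelled by changing the last letter alone, which
  would give a reduced word of value 1.\<close>

lemma val_in_C:
  assumes "word ws" "val ws \<in> C"
  shows "ws = []"
proof (rule ccontr)
  assume "ws \<noteq> []"
  then obtain vs i a where ws: "ws = vs @ [(i, a)]"
    by (metis rev_exhaust prod.exhaust)
  have c: "inv (val ws) \<in> C" using assms by auto
  have w: "word vs" "letter (i, a)" using assms ws by (auto simp: word_append word_Cons)
  have "word (vs @ [(i, a \<otimes> inv (val ws))])"
    using assms ws c by (auto simp: word_append word_Cons letter_mult_right)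
  moreover have "val (vs @ [(i, a \<otimes> inv (val ws))]) = val ws \<otimes> inv (val ws)"
    using w c word_letters_closed[of vs] letter_closed[of "(i, a)"]
    by (simp add: ws list_prod_append m_assoc inv_mult_group del: set_map)
  ultimately show False
    using reduced_word_neq_one[of "vs @ [(i, a \<otimes> inv (val ws))]"] assms by (simp add: word_iff)
qed

section \<open>Paths of cosets and the length of a quotient\<close>

definition coset :: "'a \<Rightarrow> 'a set" where
  "coset x = (\<lambda>c. x \<otimes> c) ` C"

lemma coset_eq_iff:
  assumes "x \<in> carrier G" "y \<in> carrier G"
  shows "coset x = coset y \<longleftrightarrow> inv x \<otimes> y \<in> C"
proof
  assume "coset x = coset y"
  moreover have "y \<in> coset y" using assms by (auto simp: coset_def image_iff intro!: bexI[of _ \<one>])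
  ultimately obtain c where "c \<in> C" "y = x \<otimes> c" by (auto simp: coset_def)
  then show "inv x \<otimes> y \<in> C" using assms by simp
next
  have *: "coset y \<subseteq> coset x" if "x \<in> carrier G" "y \<in> carrier G" "inv x \<otimes> y \<in> C" for x y
  proof
    fix z assume "z \<in> coset y"
    then obtain c where c: "c \<in> C" "z = y \<otimes> c" by (auto simp: coset_def)
    then have "z = x \<otimes> (inv x \<otimes> y \<otimes> c)" using that by (simp add: m_assoc)
    then show "z \<in> coset x" using that c by (auto simp: coset_def)
  qed
  assume xy: "inv x \<otimes> y \<in> C"
  have "inv (inv x \<otimes> y) \<in> C" using xy by (rule C_closed)
  then have "inv y \<otimes> x \<in> C" using assms by (simp add: inv_mult_group)
  then show "coset x = coset y" using *[of x y] *[of y x] xy assms by blast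
qed

text \<open>The vertices met by the geodesic of the Bass-Serre tree (with a vertex for each coset of
  \<open>C\<close> and of each \<open>Gi i\<close>) that leaves from the coset of \<open>p\<close> and follows a word.\<close>

fun path :: "'a \<Rightarrow> ('i \<times> 'a) list \<Rightarrow> ('i + 'a set) list" where
  "path p [] = []"
| "path p ((i, a) # ws) = Inl i # Inr (coset (p \<otimes> a)) # path (p \<otimes> a) ws"

lemma length_path [simp]: "length (path p ws) = 2 * length ws"
  by (induction p ws rule: path.induct) auto

lemma path_mult_word:
  "\<lbrakk>word ws; c \<in> C; p \<in> carrier G\<rbrakk> \<Longrightarrow> path p (mult_word c ws) = path (p \<otimes> c) ws"
  by (cases "(c, ws)" rule: mult_word.cases) (auto simp: word_Cons m_assoc dest: letter_closed)

lemma represents_ConsE: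
  assumes "represents ((i, a) # ws) x"
  obtains y where "represents ws y" "x = a \<otimes> y"
proof -
  obtain c where c: "c \<in> C" "x = val ((i, a) # ws) \<otimes> c" "word ((i, a) # ws)"
    using assms by (auto simp: represents_def)
  then have "represents ws (val ws \<otimes> c)" "x = a \<otimes> (val ws \<otimes> c)"
    by (auto simp: represents_def word_Cons m_assoc dest: letter_closed)
  then show thesis by (rule that)
qed

text \<open>Compare the first letters. Different factors: nothing cancels and the paths share
  nothing. Same factor, different cosets of \<open>C\<close>: the two letters merge into one and the
  paths share one vertex. Same coset: both letters disappear, the paths share two vertices, and the
  tails are compared from the new starting point, which is why \<open>p\<close> varies.\<close>

lemma represents_inv_mult:
  "\<lbrakk>represents us x; represents vs y; p \<in> carrier G\<rbrakk> \<Longrightarrow>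
    \<exists>ws. represents ws (inv x \<otimes> y) \<and>
      length ws + lcp_length (path p us) (path p vs) = length us + length vs"
proof (induction us arbitrary: vs x y p)
  case Nil
  then have "inv x \<in> C" by (auto simp: represents_def)
  then have "represents (mult_word (inv x) vs) (inv x \<otimes> y)"
    using Nil by (intro represents_mult_left) auto
  then show ?case by (intro exI) auto
next
  case (Cons q us)
  obtain i a where q: "q = (i, a)" by fastforce
  obtain x' where x': "represents us x'" "x = a \<otimes> x'"
    using Cons.prems q by (blast elim: represents_ConsE)
  obtain c where c: "c \<in> C" "x = val (q # us) \<otimes> c" and wu: "word (q # us)"
    using Cons.prems by (auto simp: represents_def)
  have a: "letter (i, a)" "a \<in> carrier G" using wu q by (auto simp: word_Cons dest: letter_closed)
  have inv_x: "inv x = inv c \<otimes> val (inv_word (q # us))"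
    using c wu by (simp only: val_inv_word inv_mult_group val_closed C_closed)
  show ?case
  proof (cases vs)
    case Nil
    then have y: "y \<in> C" using Cons.prems by (auto simp: represents_def)
    have "represents (mult_word (inv c) (inv_word (q # us))) (inv c \<otimes> (val (inv_word (q # us)) \<otimes> y))"
      using c wu y by (intro represents_mult_left represents_mult_right represents_val word_inv_word) auto
    moreover have "inv c \<otimes> (val (inv_word (q # us)) \<otimes> y) = inv x \<otimes> y"
      unfolding inv_x using c wu y by (intro m_assoc[symmetric] val_closed word_inv_word) auto
    ultimately show ?thesis
      using Nil by (intro exI[of _ "mult_word (inv c) (inv_word (q # us))"]) auto
  next
    case (Cons r vs')
    obtain j b where r: "r = (j, b)" by fastforce
    obtain y' where y': "represents vs' y'" "y = b \<otimes> y'"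
      using Cons.prems Cons r by (blast elim: represents_ConsE)
    obtain d where d: "d \<in> C" "y = val (r # vs') \<otimes> d" and wv: "word (r # vs')"
      using Cons.prems Cons by (auto simp: represents_def)
    have b: "letter (j, b)" "b \<in> carrier G" using wv r by (auto simp: word_Cons dest: letter_closed)
    have x'y': "x' \<in> carrier G" "y' \<in> carrier G"
      using x' y' represents_closed by auto
    consider "i \<noteq> j" | "i = j" "inv a \<otimes> b \<notin> C" | "i = j" "inv a \<otimes> b \<in> C" by blast
    then show ?thesis
    proof cases
      case 1
      let ?w = "inv_word (q # us) @ r # vs'"
      have w: "word ?w"
        using wu wv 1 q r by (auto simp: word_append last_inv_word simp del: inv_word_simps(2))
      have "represents (mult_word (inv c) ?w) (inv c \<otimes> (val ?w \<otimes> d))"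
        using c d w by (intro represents_mult_left represents_mult_right represents_val) auto
      moreover have "inv c \<otimes> (val ?w \<otimes> d) = inv x \<otimes> y"
        unfolding inv_x d(2) using c d wu wv
        by (simp only: val_append word_inv_word m_assoc val_closed C_closed m_closed)
      ultimately show ?thesis
        using 1 Cons q r by (intro exI[of _ "mult_word (inv c) ?w"]) auto
    next
      case 2
      let ?w = "inv_word us @ (i, inv a \<otimes> b) # vs'"
      have "letter (i, inv a \<otimes> b)"
        using 2 a b by (auto simp: letter_def Gi_closed)
      then have w: "word ?w"
        using wu wv 2 q r
        by (auto simp: word_append word_Cons last_inv_word simp del: inv_word_simps(2))
      have us: "word us" and vs': "word vs'" using wu wv by (auto simp: word_Cons)
      have "represents (mult_word (inv c) ?w) (inv c \<otimes> (val ?w \<otimes> d))"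
        using c d w by (intro represents_mult_left represents_mult_right represents_val) auto
      moreover have "inv c \<otimes> (val ?w \<otimes> d) = inv x \<otimes> y"
        using c d us vs' q r a b w
        by (simp add: inv_x list_prod_append word_letters_closed m_assoc val_inv_word inv_mult_group
            del: set_map)
      ultimately show ?thesis
        using 2 Cons q r a b Cons.prems
        by (intro exI[of _ "mult_word (inv c) ?w"])
          (auto simp: coset_eq_iff inv_mult_group m_assoc)
    next
      case 3
      let ?c = "inv a \<otimes> b"
      have vs': "word vs'" using wv by (auto simp: word_Cons)
      obtain ws where ws: "represents ws (inv x' \<otimes> (?c \<otimes> y'))"
        "length ws + lcp_length (path (p \<otimes> a) us) (path (p \<otimes> a) (mult_word ?c vs')) =
          length us + length (mult_word ?c vs')"
        using Cons.IH[OF x'(1) represents_mult_left[OF y'(1) 3(2)], of "p \<otimes> a"] Cons.prems a by auto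
      have "path (p \<otimes> a) (mult_word ?c vs') = path (p \<otimes> b) vs'"
        using path_mult_word[OF vs' 3(2), of "p \<otimes> a"] Cons.prems a b by (simp add: m_assoc)
      moreover have "inv x' \<otimes> (?c \<otimes> y') = inv x \<otimes> y"
        using a b x'y' by (simp add: x' y' inv_mult_group m_assoc)
      ultimately show ?thesis
        using ws 3 Cons q r a b Cons.prems
        by (intro exI[of _ ws]) (auto simp: coset_eq_iff inv_mult_group m_assoc)
    qed
  qed
qed

text \<open>For \<open>inv x \<otimes> x\<close> the remaining word is empty, so the common part has
  length \<open>length us + length vs\<close>; it is at most twice each of the two lengths.\<close>

lemma represents_length_unique:
  assumes "represents us x" "represents vs x"
  shows "length us = length vs"
proof -
  obtain ws where ws: "represents ws (inv x \<otimes> x)"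
    "length ws + lcp_length (path \<one> us) (path \<one> vs) = length us + length vs"
    using represents_inv_mult[OF assms, of \<one>] by auto
  then obtain c where c: "c \<in> C" "\<one> = val ws \<otimes> c" "word ws"
    using assms represents_closed by (auto simp: represents_def)
  then have "val ws \<otimes> c \<in> C" using C_closed(1) by metis
  then have "val ws \<in> C" using c by (simp add: C_mult_iff)
  then have "ws = []" using val_in_C c by blast
  then show ?thesis
    using ws lcp_length_le[where xs = "path \<one> us" and ys = "path \<one> vs"] by auto
qed

lemma represents_exists:
  assumes "x \<in> carrier G"
  shows "\<exists>ws. represents ws x"
proof -
  have in_Gi: "\<exists>ws. represents ws x" if "i \<in> I" "x \<in> Gi i" for i x
  proof (cases "x \<in> C")
    case True
    then show ?thesis using represents_mult_right[OF represents_Nil, of x] by auto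
  next
    case False
    then have "word [(i, x)]" using that by (simp add: word_Cons letter_def)
    then show ?thesis using represents_val[of "[(i, x)]"] that by (auto simp: Gi_closed(1))
  qed
  have "x \<in> generate G (\<Union>i\<in>I. Gi i)" using assms generate_Gi by simp
  then show ?thesis
  proof induction
    case one
    then show ?case using represents_Nil by auto
  next
    case (incl h)
    then show ?case using in_Gi by blast
  next
    case (inv h)
    then show ?case using in_Gi Gi_closed(2) by blast
  next
    case (eng x y)
    then obtain us vs where "represents us x" "represents vs y" by blast
    \<comment> \<open>The product is reached as \<open>inv (inv x) \<otimes> y\<close>, and the
      inverse as \<open>inv x \<otimes> \<one>\<close>.\<close>
    moreover obtain us' where "represents us' (inv x \<otimes> \<one>)"
      using represents_inv_mult[OF \<open>represents us x\<close> represents_Nil, of \<one>] by auto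
    ultimately show ?case
      using represents_inv_mult[of us' "inv x" vs y \<one>] represents_closed by auto
  qed
qed

definition L :: "'a \<Rightarrow> nat" where
  "L x = length (SOME ws. represents ws x)"

lemma L_represents: "represents ws x \<Longrightarrow> L x = length ws"
  unfolding L_def by (rule someI2) (auto intro: represents_length_unique)

lemma L_inv_mult:
  "\<lbrakk>represents us x; represents vs y\<rbrakk> \<Longrightarrow>
    L (inv x \<otimes> y) + lcp_length (path \<one> us) (path \<one> vs) = L x + L y"
  using represents_inv_mult[of us x vs y \<one>] by (auto simp: L_represents)

text \<open>By \<open>L_inv_mult\<close>, \<open>gp x y\<close> is the length of a common prefix of
  two paths, so the four-point condition is the ultrametric inequality for common prefixes.\<close>

sublocale length_function G L
proof
  show L_one: "L \<one> = 0"
    using L_represents[OF represents_Nil] by simp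
  show inv: "L (inv x) = L x" if x: "x \<in> carrier G" for x
  proof -
    obtain us where us: "represents us x" using represents_exists[OF x] by blast
    show ?thesis
      using L_inv_mult[OF us represents_Nil] L_one x
        lcp_length_le(2)[where xs = "path \<one> us" and ys = "path \<one> []"] by simp
  qed
  show "L (x \<otimes> y) \<le> L x + L y" if xy: "x \<in> carrier G" "y \<in> carrier G" for x y
  proof -
    obtain us where us: "represents us (inv x)" using represents_exists xy by blast
    obtain vs where vs: "represents vs y" using represents_exists[OF xy(2)] by blast
    show ?thesis using L_inv_mult[OF us vs] xy inv by simp
  qed
  fix x y z assume "x \<in> carrier G" "y \<in> carrier G" "z \<in> carrier G"
  then obtain us vs ws where "represents us x" "represents vs y" "represents ws z"
    using represents_exists by meson
  then show "min (int (L x) + int (L y) - int (L (inv x \<otimes> y)))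
      (int (L y) + int (L z) - int (L (inv y \<otimes> z)))
    \<le> int (L x) + int (L z) - int (L (inv x \<otimes> z))"
    using L_inv_mult[of us x vs y] L_inv_mult[of vs y ws z] L_inv_mult[of us x ws z]
      lcp_length_ultrametric[of "path \<one> us" "path \<one> vs" "path \<one> ws"]
    by linarith
qed

lemma L_val: "word ws \<Longrightarrow> L (val ws) = length ws"
  by (simp add: L_represents represents_val)

lemma L_eq_0_iff: "x \<in> carrier G \<Longrightarrow> L x = 0 \<longleftrightarrow> x \<in> C"
proof
  assume "x \<in> carrier G" "L x = 0"
  then obtain ws where "represents ws x" "ws = []"
    using represents_exists L_represents by fastforce
  then show "x \<in> C" by (auto simp: represents_def)
next
  assume "x \<in> C"
  then have "represents [] x" by (auto simp: represents_def)
  then show "L x = 0" using L_represents by force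
qed

lemma L_letter: "letter (i, a) \<Longrightarrow> L a = 1"
  using L_val[of "[(i, a)]"] letter_closed[of "(i, a)"] by (simp add: word_Cons)

lemma L_mult_C:
  assumes "x \<in> carrier G" "c \<in> C"
  shows "L (x \<otimes> c) = L x" and "L (c \<otimes> x) = L x"
proof -
  obtain ws where "represents ws x" using represents_exists assms by blast
  then have "represents ws (x \<otimes> c)" "represents (mult_word c ws) (c \<otimes> x)"
    using assms represents_mult_right represents_mult_left by auto
  then show "L (x \<otimes> c) = L x" "L (c \<otimes> x) = L x"
    using L_represents \<open>represents ws x\<close> by auto
qed

end

section \<open>Geodesics and axes\<close>

context amalgam
begin

lemma L_Gi_le: "\<lbrakk>i \<in> I; a \<in> Gi i\<rbrakk> \<Longrightarrow> L a \<le> 1"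
  by (cases "a \<in> C") (auto simp: L_eq_0_iff[THEN iffD2] L_letter letter_def)

lemma L_val_le: "\<forall>p\<in>set ws. fst p \<in> I \<and> snd p \<in> Gi (fst p) \<Longrightarrow> L (val ws) \<le> length ws"
proof (induction ws)
  case (Cons p ws)
  have "set (map snd ws) \<subseteq> carrier G" "snd p \<in> carrier G"
    using Cons.prems Gi_closed(1) by auto
  then have "L (val (p # ws)) \<le> L (snd p) + L (val ws)"
    using L_triangle by simp
  then show ?case using Cons L_Gi_le[of "fst p" "snd p"] by auto
qed (simp add: L_one)

definition on_geodesic :: "'a \<Rightarrow> 'a \<Rightarrow> bool" where
  "on_geodesic y x \<longleftrightarrow> y \<in> carrier G \<and> L y + L (inv y \<otimes> x) = L x"

lemma on_geodesicI: "\<lbrakk>y \<in> carrier G; z \<in> carrier G; x = y \<otimes> z; L x = L y + L z\<rbrakk> \<Longrightarrow> on_geodesic y x"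
  by (simp add: on_geodesic_def)

lemma gp_on_geodesic: "on_geodesic y x \<Longrightarrow> gp y x = 2 * int (L y)"
  by (simp add: on_geodesic_def gp_def)

text \<open>Two four-point inequalities, through \<open>f\<close> and then through \<open>e\<close>:
  initial parts of two geodesics agree as far as the geodesics do.\<close>

lemma gp_on_geodesics:
  assumes "on_geodesic y f" "on_geodesic z e" "f \<in> carrier G" "e \<in> carrier G"
  shows "gp y z \<ge> min (2 * int (L y)) (min (gp f e) (2 * int (L z)))"
proof -
  have yz: "y \<in> carrier G" "z \<in> carrier G" using assms by (auto simp: on_geodesic_def)
  have "gp e z = 2 * int (L z)"
    using gp_on_geodesic[OF assms(2)] gp_commute yz assms by simp
  then show ?thesis
    using gp_hyperbolic[of y f e] gp_hyperbolic[of y e z] gp_on_geodesic[OF assms(1)] yz assms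
    by linarith
qed

text \<open>A coset at depth \<open>L z\<close> has tree distance \<open>2 * L z\<close> from the
  base vertex, so it already lies in the common part of the geodesics.\<close>

lemma on_geodesics_same_coset:
  assumes "on_geodesic y f" "on_geodesic z e" "f \<in> carrier G" "e \<in> carrier G"
    and "L y = L z" "gp f e \<ge> 2 * int (L z)"
  shows "inv y \<otimes> z \<in> C"
proof -
  have yz: "y \<in> carrier G" "z \<in> carrier G" using assms by (auto simp: on_geodesic_def)
  have "L (inv y \<otimes> z) = 0"
    using gp_on_geodesics[OF assms(1-4)] assms(5,6) by (simp add: gp_def)
  then show ?thesis using yz by (simp add: L_eq_0_iff)
qed

lemma on_geodesic_val:
  assumes "word (us @ vs)" "c \<in> C"
  shows "on_geodesic (val us) (val (us @ vs) \<otimes> c)"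
proof (rule on_geodesicI)
  have w: "word us" "word vs" using assms by (auto simp: word_append)
  show "val us \<in> carrier G" "val vs \<otimes> c \<in> carrier G" using w assms by auto
  show "val (us @ vs) \<otimes> c = val us \<otimes> (val vs \<otimes> c)"
    using w assms by (simp add: val_append m_assoc del: map_append)
  show "L (val (us @ vs) \<otimes> c) = L (val us) + L (val vs \<otimes> c)"
    using w assms by (simp add: L_mult_C L_val del: map_append)
qed

lemma on_geodesic_letter_exists:
  assumes "f \<in> carrier G" "j < L f"
  obtains y s k where "on_geodesic y f" "L y = j" "letter (s, k)"
    "on_geodesic (y \<otimes> k) f" "L (y \<otimes> k) = Suc j"
proof -
  obtain ws where "represents ws f" using represents_exists assms by blast
  then obtain c where c: "c \<in> C" "f = val ws \<otimes> c" "word ws" and len: "L f = length ws"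
    by (auto simp: represents_def L_represents)
  obtain s k where p: "ws ! j = (s, k)" by fastforce
  have j: "j < length ws" using assms len by simp
  have take: "word (take n ws)" for n
    using c(3) append_take_drop_id[of n ws] word_append by metis
  have Suc: "val (take (Suc j) ws) = val (take j ws) \<otimes> k"
    using j p word_letters_closed[OF c(3)] word_letters_closed[OF take[of j]]
    by (subst take_Suc_conv_app_nth)
      (force simp: list_prod_append subset_iff in_set_conv_nth)+
  have len_take: "L (val (take n ws)) = min (length ws) n" for n
    using take by (simp add: L_val)
  have geo: "on_geodesic (val (take n ws)) f" for n
    using on_geodesic_val[of "take n ws" "drop n ws" c] c by simp
  show thesis
  proof (rule that)
    show "on_geodesic (val (take j ws)) f" "L (val (take j ws)) = j"
      using geo len_take j by auto
    show "letter (s, k)" using c(3) j p by (metis nth_mem word_def)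
    show "on_geodesic (val (take j ws) \<otimes> k) f" "L (val (take j ws) \<otimes> k) = Suc j"
      using geo[of "Suc j"] len_take[of "Suc j"] j by (simp_all add: Suc)
  qed
qed

text \<open>For different factors, \<open>inv k \<otimes> c\<close> and \<open>a\<close> would form
  a reduced word of length 2.\<close>

lemma letters_same_index:
  assumes "letter (s, k)" "letter (t, a)" "c \<in> C" "L (inv k \<otimes> c \<otimes> a) \<le> 1"
  shows "s = t"
proof (rule ccontr)
  assume "s \<noteq> t"
  then have "word [(s, inv k \<otimes> c), (t, a)]"
    using assms by (auto simp: word_Cons intro: letter_inv letter_mult_right)
  from L_val[OF this] show False
    using assms letter_closed[of "(s, k)"] letter_closed[of "(t, a)"] by (simp add: m_assoc)
qed

text \<open>Conjugation by \<open>f\<close> reflects the tail of the geodesic to \<open>e b\<close> in the midpoint of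
  the geodesic from \<open>b\<close> to \<open>inv f b\<close>. This moves the vertex \<open>x b\<close> towards \<open>b\<close> if it lies
  beyond the midpoint and the geodesic to \<open>e b\<close> passes through it.\<close>

lemma L_conj_beyond_midpoint:
  assumes G: "f \<in> carrier G" "x \<in> carrier G" "w \<in> carrier G"
    and e: "e = x \<otimes> w \<otimes> inv x" "L e = 2 * L x + L w"
    and c: "gp (inv f) e \<ge> L f" "2 * L x \<ge> L f"
  shows "L (f \<otimes> e \<otimes> inv f) \<le> L e"
    and "\<lbrakk>gp (inv f) e > L f; 2 * L x > L f\<rbrakk> \<Longrightarrow> L (f \<otimes> e \<otimes> inv f) < L e"
proof -
  have eG: "e \<in> carrier G" using G e by simp
  have "inv x \<otimes> e = w \<otimes> inv x" using G e by (simp add: m_assoc)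
  \<comment> \<open>The assumed length of \<open>e\<close> leaves no slack in the triangle
    inequalities, so \<open>x b\<close> lies on the geodesic to \<open>e b\<close>.\<close>
  then have "L (inv x \<otimes> e) \<le> L w + L x"
    using L_triangle[of w "inv x"] L_inv[of x] G by simp
  moreover have "L e \<le> L x + L (inv x \<otimes> e)"
    using L_triangle[of x "inv x \<otimes> e"] G eG by simp
  ultimately have "on_geodesic x e" using e G by (simp add: on_geodesic_def)
  then have "gp e x = 2 * int (L x)" using gp_on_geodesic gp_commute[of e x] G eG by simp
  then have \<kappa>: "gp (inv f) x \<ge> min (gp (inv f) e) (2 * int (L x))"
    using gp_hyperbolic[of "inv f" e x] G eG by simp
  have "f \<otimes> e \<otimes> inv f = (f \<otimes> x) \<otimes> w \<otimes> inv (f \<otimes> x)"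
    using G e by (simp add: m_assoc inv_mult_group)
  then have "L (f \<otimes> e \<otimes> inv f) \<le> 2 * L (f \<otimes> x) + L w"
    using L_conj_le[of "f \<otimes> x" w] G by simp
  moreover have "int (L (f \<otimes> x)) = int (L f) + int (L x) - gp (inv f) x"
    using L_mult G by simp
  ultimately show "L (f \<otimes> e \<otimes> inv f) \<le> L e"
    and "\<lbrakk>gp (inv f) e > L f; 2 * L x > L f\<rbrakk> \<Longrightarrow> L (f \<otimes> e \<otimes> inv f) < L e"
    using \<kappa> c e(2) by linarith+
qed

text \<open>The same for the vertex \<open>x (Gi t)\<close>, which comes next after \<open>x C\<close> on the geodesic.\<close>

lemma L_conj_beyond_midpoint_Gi:
  assumes G: "f \<in> carrier G" "x \<in> carrier G" "w \<in> carrier G"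
    and e: "e = x \<otimes> w \<otimes> inv x" "L e = 2 * L x + L w"
    and c: "gp (inv f) e \<ge> 2 * L x + 1" "L f \<le> 2 * L x + 1" "L x < L f"
    and a: "letter (t, a)" "on_geodesic (x \<otimes> a) e" "L (x \<otimes> a) = Suc (L x)"
    and w: "\<And>h. h \<in> Gi t \<Longrightarrow> L (inv h \<otimes> w \<otimes> h) \<le> L w"
  shows "L (f \<otimes> e \<otimes> inv f) + 2 * L x + 2 \<le> 2 * L f + L w"
proof -
  have eG: "e \<in> carrier G" using G e by simp
  have aG: "a \<in> carrier G" and t: "t \<in> I" using a letter_closed[of "(t, a)"] by (auto simp: letter_def)
  have "L (inv f) = L f" using L_inv G by simp
  \<comment> \<open>\<open>y b\<close> is the vertex at the depth of \<open>x b\<close> on the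
    geodesic to \<open>inv f b\<close>, and \<open>k\<close> is the letter read next.\<close>
  then obtain y s k where y: "on_geodesic y (inv f)" "L y = L x" "letter (s, k)"
    "on_geodesic (y \<otimes> k) (inv f)" "L (y \<otimes> k) = Suc (L x)"
    using on_geodesic_letter_exists[of "inv f" "L x"] G c by auto
  have yk: "y \<in> carrier G" "k \<in> carrier G"
    using y letter_closed[of "(s, k)"] by (auto simp: on_geodesic_def)
  have ax: "inv (x \<otimes> a) \<otimes> e = inv a \<otimes> (inv x \<otimes> e)"
    using G aG eG by (simp add: m_assoc inv_mult_group)
  have "L (inv x \<otimes> e) \<le> 1 + L (inv (x \<otimes> a) \<otimes> e)"
    using L_triangle[of a "inv (x \<otimes> a) \<otimes> e"] L_letter[OF a(1)] aG G eG by (simp add: ax)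
  moreover have "L e \<le> L x + L (inv x \<otimes> e)"
    using L_triangle[of x "inv x \<otimes> e"] G eG by simp
  ultimately have x: "on_geodesic x e"
    using a(2,3) G by (simp add: on_geodesic_def)
  have "inv x \<otimes> y \<in> C"
  proof -
    have "inv y \<otimes> x \<in> C"
      using on_geodesics_same_coset[OF y(1) x] y(2) c G eG by simp
    then have "inv (inv y \<otimes> x) \<in> C" by (rule C_closed)
    then show ?thesis using G yk by (simp add: inv_mult_group)
  qed
  then obtain d where d: "d \<in> C" "y = x \<otimes> d"
    using G yk inv_mult_cancel(2)[of x y] by metis
  \<comment> \<open>The common part reaches one edge beyond \<open>x b\<close>, to the vertex
    \<open>x (Gi t)\<close>. So the next letters lie in the same factor, although they may lead to
    different cosets of \<open>C\<close>.\<close>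
  have "gp (y \<otimes> k) (x \<otimes> a) \<ge> 2 * L x + 1"
    using gp_on_geodesics[OF y(4) a(2)] y(5) a(3) c(1) G eG by simp
  then have "L (inv (y \<otimes> k) \<otimes> (x \<otimes> a)) \<le> 1"
    using y(5) a(3) by (simp add: gp_def)
  moreover have "inv (y \<otimes> k) \<otimes> (x \<otimes> a) = inv k \<otimes> inv d \<otimes> a"
    using G yk aG d by (simp add: m_assoc inv_mult_group)
  ultimately have "s = t"
    using letters_same_index[OF y(3) a(1), of "inv d"] d by simp
  \<comment> \<open>Turning by \<open>h\<close> about the vertex \<open>x (Gi t)\<close> leads to
    the next coset on the geodesic to \<open>inv f b\<close>. Replacing \<open>x\<close> by
    \<open>x h\<close> and \<open>w\<close> by its conjugate costs nothing, by the hypothesis on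
    \<open>w\<close>.\<close>
  define h where "h = d \<otimes> k"
  have h: "h \<in> Gi t" "h \<in> carrier G"
    using t y(3) d yk \<open>s = t\<close> unfolding h_def by (auto simp: letter_def Gi_closed)
  have xh: "x \<otimes> h = y \<otimes> k" using G yk d by (simp add: h_def m_assoc)
  have "gp (inv f) (x \<otimes> h) = 2 * int (L (x \<otimes> h))"
    unfolding xh using gp_on_geodesic[OF y(4)] gp_commute[of "inv f" "y \<otimes> k"] G yk by simp
  then have "int (L (f \<otimes> (x \<otimes> h))) = int (L f) - int (L x) - 1"
    using L_mult[of f "x \<otimes> h"] G h y(5) yk by (simp add: xh)
  moreover have "f \<otimes> e \<otimes> inv f =
      (f \<otimes> (x \<otimes> h)) \<otimes> (inv h \<otimes> w \<otimes> h) \<otimes> inv (f \<otimes> (x \<otimes> h))"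
    using G h e by (simp add: m_assoc inv_mult_group)
  then have "L (f \<otimes> e \<otimes> inv f) \<le> 2 * L (f \<otimes> (x \<otimes> h)) + L (inv h \<otimes> w \<otimes> h)"
    using L_conj_le[of "f \<otimes> (x \<otimes> h)" "inv h \<otimes> w \<otimes> h"] G h by simp
  ultimately show ?thesis using w[OF h(1)] by linarith
qed

text \<open>For \<open>\<eta> = 0\<close> the coset \<open>x C\<close> is meant to lie on the axis;
  for \<open>\<eta> = 1\<close> it is adjacent to the vertex \<open>x (Gi t)\<close> of the axis.
  Then \<open>a\<close> and \<open>a'\<close> are the next letters towards \<open>e b\<close> and
  \<open>inv e b\<close>; both are recorded to make the notion symmetric under inversion.\<close>

definition axis_split :: "'a \<Rightarrow> 'a \<Rightarrow> 'a \<Rightarrow> nat \<Rightarrow> bool" where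
  "axis_split e x w \<eta> \<longleftrightarrow> x \<in> carrier G \<and> w \<in> carrier G \<and> e = x \<otimes> w \<otimes> inv x \<and>
    L e = 2 * L x + L w \<and> \<eta> \<le> 1 \<and>
    (\<eta> = 1 \<longrightarrow> (\<exists>t a a'. (\<forall>h\<in>Gi t. L (inv h \<otimes> w \<otimes> h) \<le> L w) \<and>
      letter (t, a) \<and> on_geodesic (x \<otimes> a) e \<and> L (x \<otimes> a) = Suc (L x) \<and>
      letter (t, a') \<and> on_geodesic (x \<otimes> a') (inv e) \<and> L (x \<otimes> a') = Suc (L x)))"

text \<open>\<open>Y\<close> is to contain the cosets of \<open>C\<close> on the axis of \<open>e\<close>. The axis is at distance \<open>2 r - \<eta>\<close>
  from \<open>b\<close>, and its vertex closest to \<open>b\<close> is a coset of \<open>C\<close> if \<open>\<eta> = 0\<close> and of \<open>Gi t\<close> if \<open>\<eta> = 1\<close>.\<close>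

definition axis_form :: "'a \<Rightarrow> 'a set \<Rightarrow> nat \<Rightarrow> nat \<Rightarrow> bool" where
  "axis_form e Y r \<eta> \<longleftrightarrow> (\<forall>y\<in>Y. e \<otimes> y \<in> Y \<and> inv e \<otimes> y \<in> Y) \<and> 2 * r + 1 \<le> L e \<and>
    (\<forall>j. r \<le> j \<longrightarrow> j + r \<le> L e \<longrightarrow> (\<exists>y\<in>Y. on_geodesic y e \<and> L y = j)) \<and>
    (\<exists>x w. L x + \<eta> = r \<and> axis_split e x w \<eta>)"

lemma axis_split_inv:
  assumes "axis_split e x w \<eta>"
  shows "axis_split (inv e) x (inv w) \<eta>"
proof -
  have xw: "x \<in> carrier G" "w \<in> carrier G" "e = x \<otimes> w \<otimes> inv x" "L e = 2 * L x + L w" "\<eta> \<le> 1"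
    using assms by (auto simp: axis_split_def)
  then have e: "e \<in> carrier G" "L (inv e) = L e" using L_inv by auto
  have w: "L (inv w) = L w" "inv e = x \<otimes> inv w \<otimes> inv x"
    using xw L_inv by (auto simp: inv_mult_group m_assoc)
  have "\<exists>t a a'. (\<forall>h\<in>Gi t. L (inv h \<otimes> inv w \<otimes> h) \<le> L (inv w)) \<and>
      letter (t, a) \<and> on_geodesic (x \<otimes> a) (inv e) \<and> L (x \<otimes> a) = Suc (L x) \<and>
      letter (t, a') \<and> on_geodesic (x \<otimes> a') (inv (inv e)) \<and> L (x \<otimes> a') = Suc (L x)" if "\<eta> = 1"
  proof -
    obtain t a a' where t: "\<forall>h\<in>Gi t. L (inv h \<otimes> w \<otimes> h) \<le> L w"
      "letter (t, a) \<and> on_geodesic (x \<otimes> a) e \<and> L (x \<otimes> a) = Suc (L x)"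
      "letter (t, a') \<and> on_geodesic (x \<otimes> a') (inv e) \<and> L (x \<otimes> a') = Suc (L x)"
      using assms \<open>\<eta> = 1\<close> by (simp add: axis_split_def) metis
    have "L (inv h \<otimes> inv w \<otimes> h) = L (inv h \<otimes> w \<otimes> h)" if "h \<in> Gi t" for h
    proof -
      have "h \<in> carrier G" using t(2) Gi_closed(1)[of t h] that by (simp add: letter_def)
      then show ?thesis
        using xw L_inv[of "inv h \<otimes> w \<otimes> h"] by (simp add: inv_mult_group m_assoc)
    qed
    then have "\<forall>h\<in>Gi t. L (inv h \<otimes> inv w \<otimes> h) \<le> L (inv w)"
      using t(1) w(1) by simp
    moreover have "inv (inv e) = e" using e by simp
    ultimately show ?thesis using t by metis
  qed
  moreover have "L (inv e) = 2 * L x + L (inv w)" "inv w \<in> carrier G"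
    using xw(2,4) w(1) e(2) by simp_all
  ultimately show ?thesis
    unfolding axis_split_def using xw(1,5) w(2) by (intro conjI impI)
qed

lemma axis_split_closed: "axis_split e x w \<eta> \<Longrightarrow> e \<in> carrier G"
  by (auto simp: axis_split_def)

lemma axis_form_closed: "axis_form e Y r \<eta> \<Longrightarrow> e \<in> carrier G"
  by (auto simp: axis_form_def dest: axis_split_closed)

text \<open>Translation by \<open>inv e\<close> takes the axis coset at depth \<open>L e - j\<close>
  on the geodesic to \<open>e b\<close> to one at depth \<open>j\<close> on the geodesic to
  \<open>inv e b\<close>.\<close>

lemma axis_form_inv:
  assumes "axis_form e Y r \<eta>"
  shows "axis_form (inv e) Y r \<eta>"
proof -
  have e: "e \<in> carrier G" "L (inv e) = L e" using axis_form_closed[OF assms] L_inv by auto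
  have "\<exists>y\<in>Y. on_geodesic y (inv e) \<and> L y = j" if j: "r \<le> j" "j + r \<le> L e" for j
  proof -
    have "r \<le> L e - j" "L e - j + r \<le> L e" using j by auto
    then obtain y where y: "y \<in> Y" "on_geodesic y e" "L y = L e - j"
      using assms unfolding axis_form_def by blast
    have "inv e \<otimes> y \<in> Y" using assms y by (auto simp: axis_form_def)
    moreover have "y \<in> carrier G" using y by (auto simp: on_geodesic_def)
    then have "L (inv e \<otimes> y) = j" "on_geodesic (inv e \<otimes> y) (inv e)"
      using y j e L_inv_mult_commute[of y e] L_inv[of y]
      by (auto simp: on_geodesic_def inv_mult_group m_assoc)
    ultimately show ?thesis by blast
  qed
  then show ?thesis
    using assms e axis_split_inv unfolding axis_form_def by (metis inv_inv)
qed

text \<open>The midpoint of the geodesic to \<open>inv f b\<close> has distance \<open>L f\<close>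
  from \<open>b\<close>, the axis of \<open>e\<close> has distance \<open>2 * r - \<eta>\<close>; so
  the hypothesis puts the midpoint no later than the start of the axis.\<close>

lemma axis_form_conj:
  assumes e: "axis_form e Y r \<eta>" and f: "f \<in> carrier G"
    and c: "gp (inv f) e \<ge> L f" "L f + \<eta> \<le> 2 * r"
  shows "L (f \<otimes> e \<otimes> inv f) \<le> L e"
    and "\<lbrakk>gp (inv f) e > L f; L f + \<eta> < 2 * r\<rbrakk> \<Longrightarrow> L (f \<otimes> e \<otimes> inv f) < L e"
proof -
  obtain x w where split: "L x + \<eta> = r" "axis_split e x w \<eta>"
    using e unfolding axis_form_def by blast
  then have xw: "x \<in> carrier G" "w \<in> carrier G" "e = x \<otimes> w \<otimes> inv x"
      "L e = 2 * L x + L w" "L x + \<eta> = r" and "\<eta> \<le> 1"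
    by (auto simp: axis_split_def)
  have \<eta>: "\<exists>t a. (\<forall>h\<in>Gi t. L (inv h \<otimes> w \<otimes> h) \<le> L w) \<and>
      letter (t, a) \<and> on_geodesic (x \<otimes> a) e \<and> L (x \<otimes> a) = Suc (L x)" if "\<eta> = 1"
    using split(2) that by (simp add: axis_split_def) metis
  have Gi: "L (f \<otimes> e \<otimes> inv f) + 2 * L x + 2 \<le> 2 * L f + L w"
    if "\<eta> = 1" "gp (inv f) e \<ge> 2 * L x + 1" "L f \<le> 2 * L x + 1" "L x < L f"
    using L_conj_beyond_midpoint_Gi[OF f xw(1-4) that(2-4)] \<eta>[OF that(1)] by blast
  \<comment> \<open>In the strict case this forces \<open>L f > 0\<close>, which yields
    \<open>L x < L f\<close> when \<open>L f = 2 * L x\<close>.\<close>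
  have "gp (inv f) e \<le> 2 * int (L f)"
    using gp_le_left[of "inv f" e] f xw L_inv[of f] by simp
  note C = L_conj_beyond_midpoint[OF f xw(1-4) c(1)]
  show "L (f \<otimes> e \<otimes> inv f) \<le> L e"
  proof (cases "L f \<le> 2 * L x")
    case True
    then show ?thesis using C by simp
  next
    case False
    \<comment> \<open>Here the midpoint is exactly the vertex \<open>x (Gi t)\<close>.\<close>
    then have "\<eta> = 1" "L f = 2 * L x + 1" using xw(5) c \<open>\<eta> \<le> 1\<close> by linarith+
    then show ?thesis using Gi c xw(4) by simp
  qed
  show "L (f \<otimes> e \<otimes> inv f) < L e" if "gp (inv f) e > L f" "L f + \<eta> < 2 * r"
  proof (cases "L f < 2 * L x")
    case True
    then show ?thesis using C that by simp
  next
    case False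
    then have "\<eta> = 1" "L f = 2 * L x" using xw(5) that \<open>\<eta> \<le> 1\<close> by linarith+
    then show ?thesis using Gi that xw(4) \<open>gp (inv f) e \<le> 2 * int (L f)\<close> by simp
  qed
qed

text \<open>Axis cosets occur at all depths from \<open>r\<close> to \<open>L e - r\<close>. Try the
  depth \<open>r1\<close> if \<open>r2 \<le> r1\<close>, and \<open>r2\<close> otherwise. If this
  depth leaves the common part or the axis stretch of \<open>f\<close>, then the axis of
  \<open>e\<close> starts at or beyond the midpoint for \<open>f\<close>, and conjugation by
  \<open>f\<close> helps.\<close>

lemma axis_form_overlap:
  assumes f: "axis_form f Yf r1 \<eta>1" and e: "axis_form e Ye r2 \<eta>2"
    and c: "gp (inv f) e \<ge> L f" "L f \<le> L e"
  shows "(\<exists>y\<in>Yf. \<exists>z\<in>Ye. y \<in> carrier G \<and> z \<in> carrier G \<and> inv y \<otimes> z \<in> C) \<or>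
    L f < L e \<and> L (f \<otimes> e \<otimes> inv f) \<le> L e \<and>
      (gp (inv f) e > L f \<longrightarrow> L (f \<otimes> e \<otimes> inv f) < L e)"
proof -
  have G: "f \<in> carrier G" "e \<in> carrier G" using e f by (auto dest: axis_form_closed)
  have r: "2 * r1 + 1 \<le> L f" "2 * r2 + 1 \<le> L e" "\<eta>2 \<le> 1"
    using e f by (auto simp: axis_form_def axis_split_def)
  have share: "\<exists>y\<in>Yf. \<exists>z\<in>Ye. y \<in> carrier G \<and> z \<in> carrier G \<and> inv y \<otimes> z \<in> C"
    if j: "r1 \<le> j" "j + r1 \<le> L f" "r2 \<le> j" "j + r2 \<le> L e" "2 * int j \<le> gp (inv f) e" for j
  proof -
    obtain y where y: "y \<in> Yf" "on_geodesic y (inv f)" "L y = j"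
      using axis_form_inv[OF f] j(1,2) L_inv[OF G(1)] unfolding axis_form_def by metis
    obtain z where z: "z \<in> Ye" "on_geodesic z e" "L z = j"
      using e j(3,4) unfolding axis_form_def by metis
    have "inv y \<otimes> z \<in> C"
      using on_geodesics_same_coset[OF y(2) z(2)] y z j(5) G by simp
    then show ?thesis using y z by (auto simp: on_geodesic_def)
  qed
  show ?thesis
  proof (cases "r2 \<le> r1 \<or> 2 * int r2 \<le> gp (inv f) e \<and> r2 + r1 \<le> L f")
    case True
    then show ?thesis
      using share[of r1] share[of r2] r c by (cases "r2 \<le> r1") auto
  next
    case False
    then have "L f + \<eta>2 \<le> 2 * r2" "gp (inv f) e > L f \<longrightarrow> L f + \<eta>2 < 2 * r2"
      using r c by auto
    moreover have "L f < L e" using False r c by auto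
    ultimately show ?thesis using axis_form_conj[OF e G(1) c(1)] by blast
  qed
qed

text \<open>A period of the axis, read from the coset \<open>x C\<close>; the prefixes give the
  cosets of \<open>C\<close> that it visits.\<close>

definition axis_word :: "'a \<Rightarrow> 'a set \<Rightarrow> 'a \<Rightarrow> ('i \<times> 'a) list \<Rightarrow> bool" where
  "axis_word e Y x bs \<longleftrightarrow> x \<in> carrier G \<and> word bs \<and> bs \<noteq> [] \<and> fst (hd bs) \<noteq> fst (last bs) \<and>
    e = x \<otimes> val bs \<otimes> inv x \<and> (\<forall>us vs. bs = us @ vs \<longrightarrow> x \<otimes> val us \<in> Y)"

lemma axis_wordD:
  assumes "axis_word e Y x bs"
  shows "x \<in> carrier G" "word bs" "bs \<noteq> []" "fst (hd bs) \<noteq> fst (last bs)"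
    "e = x \<otimes> val bs \<otimes> inv x" "\<And>us vs. bs = us @ vs \<Longrightarrow> x \<otimes> val us \<in> Y"
  using assms by (auto simp: axis_word_def)

lemma inv_word_inv_word: "word ws \<Longrightarrow> inv_word (inv_word ws) = ws"
  by (induction ws) (auto simp: word_Cons inv_word_append dest: letter_closed)

lemma axis_word_inv:
  assumes "axis_word e Y x bs" and Y: "\<And>y. y \<in> Y \<Longrightarrow> inv e \<otimes> y \<in> Y"
  shows "axis_word (inv e) Y x (inv_word bs)"
proof -
  note D = axis_wordD[OF assms(1)]
  have "x \<otimes> val us \<in> Y" if "inv_word bs = us @ vs" for us vs
  proof -
    have w: "word us" "word vs" using D(2) that word_inv_word word_append by metis+
    have "bs = inv_word vs @ inv_word us"
      using that inv_word_inv_word[OF D(2)] inv_word_append by metis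
    then have "val bs = inv (val vs) \<otimes> inv (val us)" "x \<otimes> inv (val vs) \<in> Y"
      using w D(6)[of "inv_word vs" "inv_word us"] by (simp_all add: val_append val_inv_word del: map_append)
    \<comment> \<open>A prefix of the inverse word ends at the \<open>inv e\<close>-translate of the
      end of a prefix of \<open>bs\<close>.\<close>
    then have "inv e \<otimes> (x \<otimes> inv (val vs)) \<in> Y" using Y by blast
    moreover have "inv e \<otimes> (x \<otimes> inv (val vs)) = x \<otimes> val us"
      using w D(1,5) \<open>val bs = _\<close> by (simp add: inv_mult_group m_assoc)
    ultimately show ?thesis by simp
  qed
  moreover have "inv e = x \<otimes> val (inv_word bs) \<otimes> inv x"
    using D(1,2,5) by (simp add: val_inv_word inv_mult_group m_assoc)
  ultimately show ?thesis
    using D unfolding axis_word_def by (simp add: hd_inv_word last_inv_word)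
qed

text \<open>The first letter absorbs \<open>c\<close> and the last one \<open>inv c\<close>. This
  permits choosing as \<open>x\<close> the value of a word.\<close>

lemma axis_word_mult_C:
  assumes "axis_word e Y x bs" "c \<in> C" and Y: "\<And>y d. y \<in> Y \<Longrightarrow> d \<in> C \<Longrightarrow> y \<otimes> d \<in> Y"
  obtains bs' where "axis_word e Y (x \<otimes> inv c) bs'"
proof -
  note D = axis_wordD[OF assms(1)]
  obtain i b ms j d where bs: "bs = (i, b) # ms @ [(j, d)]"
  proof -
    obtain i b bs1 where 1: "bs = (i, b) # bs1" using D(3) by (cases bs) auto
    then have "bs1 \<noteq> []" using D(4) by auto
    then obtain ms j d where "bs1 = ms @ [(j, d)]" by (metis rev_exhaust prod.exhaust)
    then show thesis using 1 that by simp
  qed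
  define bs' where "bs' = (i, c \<otimes> b) # ms @ [(j, d \<otimes> inv c)]"
  have lt: "letter (i, b)" "letter (j, d)" "word ms"
    using D(2) by (auto simp: bs word_Cons word_append)
  then have bd: "b \<in> carrier G" "d \<in> carrier G" "set (map snd ms) \<subseteq> carrier G"
    using letter_closed word_letters_closed by force+
  have w: "word bs'"
    using D(2) assms(2) unfolding bs'_def bs
    by (auto simp: word_def letter_mult_left letter_mult_right)
  have val_bs: "val bs' = c \<otimes> val bs \<otimes> inv c"
    using assms(2) bd by (simp add: bs bs'_def list_prod_append m_assoc del: set_map)
  have "x \<otimes> inv c \<otimes> val us \<in> Y" if us: "bs' = us @ vs" for us vs
  proof (cases "us = []")
    case True
    then show ?thesis using D(1) D(6)[of "[]" bs] assms(2) Y[of x "inv c"] by simp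
  next
    case False
    then obtain us' where us': "us = (i, c \<otimes> b) # us'" "ms @ [(j, d \<otimes> inv c)] = us' @ vs"
      using us by (cases us) (auto simp: bs'_def)
    show ?thesis
    proof (cases vs rule: rev_cases)
      case Nil
      then have "x \<otimes> inv c \<otimes> val us = x \<otimes> val bs \<otimes> inv c"
        using us val_bs D(1,2) assms(2) by (simp add: m_assoc)
      then show ?thesis using D(6)[of bs "[]"] Y assms(2) by simp
    next
      case (snoc vs' p)
      then have "bs = ((i, b) # us') @ vs' @ [(j, d)]" using us' by (simp add: bs)
      then have "x \<otimes> val ((i, b) # us') \<in> Y" by (rule D(6))
      moreover have "set (map snd us') \<subseteq> carrier G"
        using bd(3) us'(2) snoc by (metis append_assoc butlast_append butlast_snoc le_sup_iff map_append set_append)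
      then have "x \<otimes> inv c \<otimes> val us = x \<otimes> val ((i, b) # us')"
        using D(1) bd assms(2) by (simp add: us'(1) m_assoc del: set_map)
      ultimately show ?thesis by simp
    qed
  qed
  moreover have "e = (x \<otimes> inv c) \<otimes> val bs' \<otimes> inv (x \<otimes> inv c)"
    using D(1,2,5) assms(2) val_bs by (simp add: m_assoc inv_mult_group)
  moreover have "bs' \<noteq> []" "fst (hd bs') \<noteq> fst (last bs')"
    using D(4) by (simp_all add: bs bs'_def)
  ultimately have "axis_word e Y (x \<otimes> inv c) bs'"
    using D(1) assms(2) w unfolding axis_word_def by auto
  then show thesis by (rule that)
qed

text \<open>Moves the base coset one letter along the axis; the one new coset of the period is the
  \<open>e\<close>-translate of the new base coset.\<close>

lemma axis_word_rotate:
  assumes "axis_word e Y x ((t, b) # bs)" and Y: "\<And>y. y \<in> Y \<Longrightarrow> e \<otimes> y \<in> Y"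
  shows "axis_word e Y (x \<otimes> b) (bs @ [(t, b)])"
proof -
  note D = axis_wordD[OF assms(1)]
  have "bs \<noteq> []" using D(4) by auto
  then have b: "letter (t, b)" "b \<in> carrier G" "word bs" "bs \<noteq> []" "fst (last bs) \<noteq> t" "fst (hd bs) \<noteq> t"
    using D(2,4) letter_closed[of "(t, b)"] by (auto simp: word_Cons)
  from b have vb: "set (map snd bs) \<subseteq> carrier G" using word_letters_closed by blast
  have e: "e = (x \<otimes> b) \<otimes> val (bs @ [(t, b)]) \<otimes> inv (x \<otimes> b)"
    using D(1,5) b vb by (simp add: list_prod_append m_assoc inv_mult_group del: set_map)
  have "x \<otimes> b \<otimes> val us \<in> Y" if us: "bs @ [(t, b)] = us @ vs" for us vs
  proof (cases vs rule: rev_cases)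
    case Nil
    then have us': "us = bs @ [(t, b)]" using us by simp
    have "val us \<in> carrier G" using vb b(2) unfolding us' by (intro list_prod_closed) auto
    then have "x \<otimes> b \<otimes> val us = e \<otimes> (x \<otimes> b)"
      using D(1) b(2) unfolding e us'[symmetric] by (simp add: m_assoc inv_mult_group)
    then show ?thesis using Y D(6)[of "[(t, b)]" bs] b(2) by simp
  next
    case (snoc vs' p)
    then have "(t, b) # bs = ((t, b) # us) @ vs'" using us by simp
    then have "x \<otimes> val ((t, b) # us) \<in> Y" by (rule D(6))
    moreover have "word us" using b(3) us snoc by (auto simp: word_append)
    ultimately show ?thesis using D(1) b(2) by (simp add: m_assoc)
  qed
  then show ?thesis
    using e b D(1) unfolding axis_word_def by (auto simp: word_append word_Cons)
qed

text \<open>Nothing merges in \<open>xs @ bs @ inv_word xs\<close>, so the geodesic to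
  \<open>e b\<close> joins the axis at the coset of \<open>val xs\<close>.\<close>

lemma axis_form_cyclically_reduced:
  assumes "axis_word e Y (val xs) bs" "word xs"
    and xs: "xs = [] \<or> fst (last xs) \<noteq> fst (hd bs) \<and> fst (last xs) \<noteq> fst (last bs)"
    and Y: "\<And>y. y \<in> Y \<Longrightarrow> e \<otimes> y \<in> Y \<and> inv e \<otimes> y \<in> Y"
  shows "axis_form e Y (length xs) 0"
proof -
  note D = axis_wordD[OF assms(1)]
  let ?w = "xs @ bs @ inv_word xs"
  have w: "word ?w"
    using assms(2) xs D(2,3) by (auto simp: word_append hd_inv_word)
  have wi: "word (inv_word xs)" "word (bs @ inv_word xs)" "word (xs @ bs)" using assms(2) w by (auto simp: word_append)
  have e: "e = val ?w"
    using D wi assms(2) by (simp add: val_append val_inv_word m_assoc del: map_append)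
  have Le: "L e = 2 * length xs + length bs" unfolding e L_val[OF w] by simp
  have "length bs \<ge> 2" using D(3,4) by (cases bs rule: remdups_adj.cases) auto
  moreover have "\<exists>y\<in>Y. on_geodesic y e \<and> L y = j" if j: "length xs \<le> j" "j + length xs \<le> L e" for j
  proof -
    let ?k = "j - length xs"
    let ?u = "xs @ take ?k bs"
    have split: "bs = take ?k bs @ drop ?k bs" by simp
    have wu: "word (take ?k bs)" "word ?u"
      using wi(3) split word_append append_assoc by metis+
    have "?u @ drop ?k bs @ inv_word xs = ?w" by (metis append_assoc append_take_drop_id)
    from on_geodesic_val[of ?u "drop ?k bs @ inv_word xs" \<one>, unfolded this, OF w]
    have "on_geodesic (val ?u) e" unfolding e using w by (simp del: map_append)
    moreover have "L (val ?u) = j" using L_val[OF wu(2)] j Le by simp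
    moreover have "val ?u \<in> Y"
      using D(6)[OF split] wu assms(2) by (simp add: val_append del: map_append)
    ultimately show ?thesis by blast
  qed
  moreover have "axis_split e (val xs) (val bs) 0"
    using D(1,2,5) Le assms(2) by (simp add: axis_split_def L_val)
  then have "\<exists>x w. L x + 0 = length xs \<and> axis_split e x w 0"
    using L_val[OF assms(2)] by auto
  ultimately show ?thesis
    using Y Le unfolding axis_form_def by auto
qed

text \<open>Here \<open>u\<close> and \<open>b\<close> merge into one letter, so the geodesic joins
  the axis at a coset of \<open>Gi t\<close>, half a letter after the coset of
  \<open>val xs\<close>. The far end of the period does not merge with \<open>inv u\<close>, as its
  factor differs from that of \<open>b\<close>.\<close>

lemma axis_form_same_type:
  assumes "axis_word e Y (val (xs @ [(t, u)])) ((t, b) # bs)" "word (xs @ [(t, u)])" "u \<otimes> b \<notin> C"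
    and Y: "\<And>y. y \<in> Y \<Longrightarrow> e \<otimes> y \<in> Y \<and> inv e \<otimes> y \<in> Y"
  shows "axis_form e Y (Suc (length xs)) 1"
proof -
  note D = axis_wordD[OF assms(1)]
  have "bs \<noteq> []" using D(4) by auto
  then have lt: "letter (t, u)" "letter (t, b)" "word xs" "word bs" "bs \<noteq> []"
    and fst: "fst (hd bs) \<noteq> t" "fst (last bs) \<noteq> t" "xs = [] \<or> fst (last xs) \<noteq> t"
    using assms(2) D(2,4) by (auto simp: word_append word_Cons)
  have tI: "t \<in> I" using lt by (simp add: letter_def)
  have ub: "u \<in> carrier G" "b \<in> carrier G" using lt letter_closed by force+
  have let_ub: "letter (t, u \<otimes> b)"
    using lt(1,2) assms(3) by (simp add: letter_def Gi_closed)
  let ?x = "xs @ [(t, u \<otimes> b)]"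
  let ?tail = "(t, inv u) # inv_word xs"
  let ?w = "?x @ bs @ ?tail"
  have w: "word ?w"
    using lt let_ub fst letter_inv[OF lt(1)]
    by (auto simp: word_append word_Cons hd_inv_word)
  have wt: "word ?x" "word ?tail"
    using w word_append[of ?x "bs @ ?tail"] word_append[of bs ?tail] by blast+
  have e: "e = val ?w"
    using D(5) lt ub word_letters_closed[OF lt(3)] word_letters_closed[OF lt(4)]
      word_letters_closed[OF word_inv_word[OF lt(3)]]
    by (simp add: list_prod_append val_inv_word inv_mult_group m_assoc del: set_map)
  have Le: "L e = 2 * length xs + 2 + length bs" unfolding e L_val[OF w] by simp
  have "\<exists>y\<in>Y. on_geodesic y e \<and> L y = j"
    if j: "Suc (length xs) \<le> j" "j + Suc (length xs) \<le> L e" for j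
  proof -
    let ?k = "j - Suc (length xs)"
    let ?u = "?x @ take ?k bs"
    have split: "bs = take ?k bs @ drop ?k bs" by simp
    have wu: "word (take ?k bs)" "word ?u"
      using w split word_append append_assoc by metis+
    have "?u @ drop ?k bs @ ?tail = ?w" by (metis append_assoc append_take_drop_id)
    from on_geodesic_val[of ?u "drop ?k bs @ ?tail" \<one>, unfolded this, OF w]
    have "on_geodesic (val ?u) e" unfolding e using w by (simp del: map_append)
    moreover have "L (val ?u) = j" using L_val[OF wu(2)] j Le by simp
    moreover have "val (xs @ [(t, u)]) \<otimes> val ((t, b) # take ?k bs) \<in> Y"
      by (rule D(6)[of _ "drop ?k bs"]) simp
    then have "val ?u \<in> Y"
      using word_letters_closed[OF lt(3)] word_letters_closed[OF wu(1)] ub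
      by (simp add: list_prod_append m_assoc del: set_map)
    ultimately show ?thesis by blast
  qed
  moreover have split: "axis_split e (val xs) (val ((t, u \<otimes> b) # bs @ [(t, inv u)])) 1"
  proof -
    let ?m = "(t, u \<otimes> b) # bs @ [(t, inv u)]"
    have wm: "word ?m" using w lt(5) by (simp add: word_append word_Cons)
    have em: "e = val xs \<otimes> val ?m \<otimes> inv (val xs)"
      using lt ub word_letters_closed[OF lt(3)] word_letters_closed[OF lt(4)]
        word_letters_closed[OF word_inv_word[OF lt(3)]]
      by (simp add: e list_prod_append val_inv_word m_assoc del: set_map)
    \<comment> \<open>Such an \<open>h\<close> is absorbed by the two outer letters; the resulting
      word may fail to be reduced, which only shortens it.\<close>
    have conj: "L (inv h \<otimes> val ?m \<otimes> h) \<le> L (val ?m)" if h: "h \<in> Gi t" for h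
    proof -
      have hG: "h \<in> carrier G" using Gi_closed(1)[OF tI h] .
      let ?m' = "(t, inv h \<otimes> (u \<otimes> b)) # bs @ [(t, inv u \<otimes> h)]"
      have "inv h \<otimes> val ?m \<otimes> h = val ?m'"
        using hG ub word_letters_closed[OF lt(4)] by (simp add: list_prod_append m_assoc del: set_map)
      moreover have "L (val ?m') \<le> length ?m'"
        using lt let_ub letter_inv[OF lt(1)] h tI
        by (intro L_val_le) (auto simp: letter_def word_def Gi_closed)
      ultimately show ?thesis using L_val[OF wm] by simp
    qed
    have geo: "on_geodesic (val ?x) e" "on_geodesic (val (xs @ [(t, u)])) (inv e)"
    proof -
      show "on_geodesic (val ?x) e"
        using on_geodesic_val[of ?x "bs @ ?tail" \<one>] w by (simp add: e del: map_append)
      have "inv_word ?w = (xs @ [(t, u)]) @ inv_word bs @ inv_word ?x"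
        using ub inv_word_inv_word[OF lt(3)] by (simp add: inv_word_append)
      then show "on_geodesic (val (xs @ [(t, u)])) (inv e)"
        using on_geodesic_val[of "xs @ [(t, u)]" "inv_word bs @ inv_word ?x" \<one>]
          w word_inv_word[OF w] val_inv_word[OF w] by (simp add: e del: map_append inv_word_simps(2))
    qed
    have vals: "val ?x = val xs \<otimes> (u \<otimes> b)" "val (xs @ [(t, u)]) = val xs \<otimes> u"
      using ub word_letters_closed[OF lt(3)] by (simp_all add: list_prod_append del: set_map)
    have lens: "L (val ?x) = Suc (length xs)" "L (val (xs @ [(t, u)])) = Suc (length xs)"
      "L (val xs) = length xs" "L (val ?m) = length bs + 2"
      using L_val wt(1) assms(2) lt(3) wm by (simp_all del: map_append list.map)
    show ?thesis
      unfolding axis_split_def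
    proof (intro conjI impI)
      show "\<exists>t a a'. (\<forall>h\<in>Gi t. L (inv h \<otimes> val ?m \<otimes> h) \<le> L (val ?m)) \<and>
        letter (t, a) \<and> on_geodesic (val xs \<otimes> a) e \<and> L (val xs \<otimes> a) = Suc (L (val xs)) \<and>
        letter (t, a') \<and> on_geodesic (val xs \<otimes> a') (inv e) \<and> L (val xs \<otimes> a') = Suc (L (val xs))"
        using conj let_ub lt(1) geo lens vals by metis
      show "L e = 2 * L (val xs) + L (val ?m)" using Le lens by simp
    qed (use em lt(3) val_closed[OF wm] in auto)
  qed
  moreover have "\<exists>x w. L x + 1 = Suc (length xs) \<and> axis_split e x w 1"
    using L_val[OF lt(3)] split by auto
  moreover have "length bs \<ge> 1" using lt(5) by (cases bs) auto
  ultimately show ?thesis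
    using Y Le unfolding axis_form_def by auto
qed

text \<open>Start the period at the axis coset closest to \<open>b\<close>. The word leading there
  can agree in type with at most one end of the period, since the two ends have different
  types.\<close>

lemma axis_form_exists:
  assumes ex: "axis_word e Y x bs"
    and YC: "\<And>y d. y \<in> Y \<Longrightarrow> d \<in> C \<Longrightarrow> y \<otimes> d \<in> Y"
    and Y: "\<And>y. y \<in> Y \<Longrightarrow> e \<otimes> y \<in> Y \<and> inv e \<otimes> y \<in> Y"
  shows "\<exists>r \<eta>. axis_form e Y r \<eta>"
proof -
  have eG: "e \<in> carrier G" using axis_wordD[OF ex] by simp
  obtain x bs where ex: "axis_word e Y x bs"
    and min: "\<And>y cs. axis_word e Y y cs \<Longrightarrow> L x \<le> L y"
    using ex_has_least_nat[of "\<lambda>p. axis_word e Y (fst p) (snd p)" "(x, bs)" "\<lambda>p. L (fst p)"] ex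
    by (metis fst_conv snd_conv)
  have min_inv: "L x \<le> L y" if "axis_word (inv e) Y y cs" for y cs
    using axis_word_inv[OF that] Y eG min by simp
  obtain xs where "represents xs x" using represents_exists axis_wordD[OF ex] by blast
  then obtain c where c: "c \<in> C" "x = val xs \<otimes> c" "word xs" "L x = length xs"
    by (auto simp: represents_def L_represents)
  then have "x \<otimes> inv c = val xs" by (simp add: m_assoc)
  then obtain bs where bs: "axis_word e Y (val xs) bs"
    using axis_word_mult_C[OF ex c(1) YC] by metis
  note D = axis_wordD[OF bs]
  have same_type: "axis_form f Y (length xs) 1"
    if f: "axis_word f Y (val xs) cs" "xs \<noteq> []" "fst (last xs) = fst (hd cs)"
      and Yf: "\<And>y. y \<in> Y \<Longrightarrow> f \<otimes> y \<in> Y \<and> inv f \<otimes> y \<in> Y"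
      and minf: "\<And>y cs. axis_word f Y y cs \<Longrightarrow> L x \<le> L y" for f cs
  proof -
    obtain xs' t u where xs: "xs = xs' @ [(t, u)]" using f(2) by (metis rev_exhaust prod.exhaust)
    obtain b cs' where cs: "cs = (t, b) # cs'"
      using f(3) axis_wordD(3)[OF f(1)] xs by (cases cs) auto
    \<comment> \<open>Otherwise the next coset on the axis would be closer to
      \<open>b\<close>.\<close>
    have "u \<otimes> b \<notin> C"
    proof
      assume ub: "u \<otimes> b \<in> C"
      have lt: "word xs'" "u \<in> carrier G" "b \<in> carrier G"
        using c(3) axis_wordD(2)[OF f(1)] letter_closed[of "(t, u)"] letter_closed[of "(t, b)"]
        by (auto simp: xs cs word_append word_Cons)
      then have "val xs \<otimes> b = val xs' \<otimes> (u \<otimes> b)"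
        using word_letters_closed[OF lt(1)] by (simp add: xs list_prod_append m_assoc del: set_map)
      then have "L (val xs \<otimes> b) = length xs'"
        using lt ub by (simp add: L_mult_C L_val)
      moreover have "L x \<le> L (val xs \<otimes> b)"
        using axis_word_rotate[of f Y "val xs" t b cs'] f(1) Yf minf by (auto simp: cs)
      ultimately show False using c(4) xs by simp
    qed
    then show ?thesis
      using axis_form_same_type[of f Y xs' t u b cs'] f(1) c(3) Yf by (simp add: xs cs)
  qed
  consider "xs = [] \<or> fst (last xs) \<noteq> fst (hd bs) \<and> fst (last xs) \<noteq> fst (last bs)"
    | "xs \<noteq> []" "fst (last xs) = fst (hd bs)" | "xs \<noteq> []" "fst (last xs) = fst (last bs)"
    by blast
  then show ?thesis
  proof cases
    case 1
    then show ?thesis using axis_form_cyclically_reduced[OF bs c(3) _ Y] by blast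
  next
    case 2
    have "axis_form e Y (length xs) 1"
      by (rule same_type[OF bs 2]) (use Y min in blast)+
    then show ?thesis by blast
  next
    case 3
    \<comment> \<open>Agreement with the last letter becomes agreement with the first one when the
      axis is reversed.\<close>
    have inv: "axis_word (inv e) Y (val xs) (inv_word bs)"
      using axis_word_inv[OF bs] Y by blast
    have "axis_form (inv e) Y (length xs) 1"
      using same_type[OF inv 3(1)] 3(2) hd_inv_word[OF D(3)] Y eG min_inv by simp
    then have "axis_form (inv (inv e)) Y (length xs) 1" by (rule axis_form_inv)
    then show ?thesis using eG by auto
  qed
qed

end

section \<open>Products of elliptic and of hyperbolic elements\<close>

context group
begin

definition conjugates :: "'a set \<Rightarrow> 'a set" where
  "conjugates S = {x \<otimes> s \<otimes> inv x | x s. x \<in> carrier G \<and> s \<in> S}"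

lemma conjugatesI: "\<lbrakk>x \<in> carrier G; s \<in> S\<rbrakk> \<Longrightarrow> x \<otimes> s \<otimes> inv x \<in> conjugates S"
  by (auto simp: conjugates_def)

lemma subset_conjugates:
  assumes "S \<subseteq> carrier G"
  shows "S \<subseteq> conjugates S"
proof
  fix s assume "s \<in> S"
  then show "s \<in> conjugates S" using conjugatesI[of \<one> s S] assms by auto
qed

lemma conjugates_closed: "\<lbrakk>S \<subseteq> carrier G; e \<in> conjugates S\<rbrakk> \<Longrightarrow> e \<in> carrier G"
  by (auto simp: conjugates_def)

lemma conjugates_conj:
  assumes "S \<subseteq> carrier G" "e \<in> conjugates S" "y \<in> carrier G"
  shows "y \<otimes> e \<otimes> inv y \<in> conjugates S" and "inv y \<otimes> e \<otimes> y \<in> conjugates S"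
proof -
  have *: "y \<otimes> e \<otimes> inv y \<in> conjugates S" if "y \<in> carrier G" for y
  proof -
    obtain x s where "x \<in> carrier G" "s \<in> S" "e = x \<otimes> s \<otimes> inv x"
      using assms by (auto simp: conjugates_def)
    then have "y \<otimes> e \<otimes> inv y = (y \<otimes> x) \<otimes> s \<otimes> inv (y \<otimes> x)"
      using that assms by (simp add: subset_iff m_assoc inv_mult_group)
    then show ?thesis using conjugatesI[of "y \<otimes> x" s S] that \<open>x \<in> carrier G\<close> \<open>s \<in> S\<close> by simp
  qed
  show "y \<otimes> e \<otimes> inv y \<in> conjugates S" "inv y \<otimes> e \<otimes> y \<in> conjugates S"
    using *[of y] *[of "inv y"] assms(3) by simp_all
qed

lemma not_generalized_torsion_conjugates:
  assumes "S \<subseteq> carrier G" "g \<in> conjugates S"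
    and "\<And>es. \<lbrakk>set es \<subseteq> conjugates S; es \<noteq> []\<rbrakk> \<Longrightarrow> list_prod G es \<noteq> \<one>"
  shows "\<not> generalized_torsion G g"
proof
  assume "generalized_torsion G g"
  then obtain hs where hs: "hs \<noteq> []" "set hs \<subseteq> carrier G" "list_prod G (map (conj_by G g) hs) = \<one>"
    by (auto simp: generalized_torsion_def)
  have "set (map (conj_by G g) hs) \<subseteq> conjugates S"
    using hs(2) conjugates_conj(2)[OF assms(1,2)] by (auto simp: conj_by_def)
  then show False using assms(3)[of "map (conj_by G g) hs"] hs by simp
qed

end

section \<open>Nielsen's method for hyperbolic elements, and the shape of elliptic ones\<close>

context amalgam
begin

text \<open>The set in \<open>axis\<close> consists of the positions from which \<open>e\<close> is
  seen as an element of \<open>S\<close>. If \<open>e\<close> and \<open>f\<close> have a coset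
  \<open>y C\<close> of such positions in common, conjugation by \<open>y\<close> takes both into
  the semigroup \<open>S\<close>, hence also their product.\<close>

theorem list_prod_neq_one_hyperbolic:
  assumes S: "S \<subseteq> carrier G" "\<And>s t. \<lbrakk>s \<in> S; t \<in> S\<rbrakk> \<Longrightarrow> s \<otimes> t \<in> S"
      "\<And>s c. \<lbrakk>s \<in> S; c \<in> C\<rbrakk> \<Longrightarrow> c \<otimes> s \<otimes> inv c \<in> S"
    and axis: "\<And>e. e \<in> conjugates S \<Longrightarrow>
      \<exists>r \<eta>. axis_form e {y \<in> carrier G. inv y \<otimes> e \<otimes> y \<in> S} r \<eta>"
    and es: "set es \<subseteq> conjugates S" "es \<noteq> []"
  shows "list_prod G es \<noteq> \<one>"
proof -
  note conj_closed = conjugates_closed[OF S(1)]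
  have overlap: "e \<otimes> f \<in> conjugates S"
    if "e \<in> carrier G" "f \<in> carrier G" "y \<in> carrier G" "z \<in> carrier G" "inv y \<otimes> z \<in> C"
      "inv y \<otimes> e \<otimes> y \<in> S" "inv z \<otimes> f \<otimes> z \<in> S" for e f y z
  proof -
    define c where "c = inv y \<otimes> z"
    have c: "c \<in> C" "z = y \<otimes> c" using that by (simp_all add: c_def)
    have "c \<otimes> (inv z \<otimes> f \<otimes> z) \<otimes> inv c \<in> S" using S(3) that c by blast
    moreover have "c \<otimes> (inv z \<otimes> f \<otimes> z) \<otimes> inv c = inv y \<otimes> f \<otimes> y"
      using that c by (simp add: m_assoc inv_mult_group)
    ultimately have "(inv y \<otimes> e \<otimes> y) \<otimes> (inv y \<otimes> f \<otimes> y) \<in> S" using S(2) that by simp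
    moreover have "e \<otimes> f = y \<otimes> ((inv y \<otimes> e \<otimes> y) \<otimes> (inv y \<otimes> f \<otimes> y)) \<otimes> inv y"
      using that by (simp add: m_assoc)
    ultimately show ?thesis using conjugatesI that by metis
  qed
  show ?thesis
  proof (rule list_prod_neq_one_Nielsen[OF _ _ _ _ _ es])
    show "conjugates S \<subseteq> carrier G" using conj_closed by blast
    show "\<one> \<notin> conjugates S" using axis[of \<one>] L_one by (auto simp: axis_form_def)
    show "e \<otimes> f \<otimes> inv e \<in> conjugates S \<and> inv f \<otimes> e \<otimes> f \<in> conjugates S"
      if "e \<in> conjugates S" "f \<in> conjugates S" for e f
      using that conjugates_conj[OF S(1)] conj_closed by blast
  next
    fix e f assume ef: "e \<in> conjugates S" "f \<in> conjugates S" "L e \<le> L f" "int (L e) \<le> gp (inv e) f"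
    have G: "e \<in> carrier G" "f \<in> carrier G" using ef conj_closed by auto
    obtain r \<eta> r' \<eta>' where "axis_form e {y \<in> carrier G. inv y \<otimes> e \<otimes> y \<in> S} r \<eta>"
      "axis_form f {y \<in> carrier G. inv y \<otimes> f \<otimes> y \<in> S} r' \<eta>'"
      using axis ef by meson
    from axis_form_overlap[OF this ef(4,3)] show "e \<otimes> f \<in> conjugates S \<or>
        L e < L f \<and> L (e \<otimes> f \<otimes> inv e) \<le> L f"
      using overlap G by blast
  next
    fix e f assume ef: "e \<in> conjugates S" "f \<in> conjugates S" "L f \<le> L e" "int (L f) < gp (inv e) f"
    have G: "e \<in> carrier G" "f \<in> carrier G" using ef conj_closed by auto
    obtain r \<eta> r' \<eta>' where "axis_form e {y \<in> carrier G. inv y \<otimes> e \<otimes> y \<in> S} r \<eta>"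
      "axis_form f {y \<in> carrier G. inv y \<otimes> f \<otimes> y \<in> S} r' \<eta>'"
      using axis ef by meson
    \<comment> \<open>Although \<open>S\<close> need not contain inverses, axes pass to inverses. So
      this alternative is the previous overlap applied to \<open>inv f\<close> and
      \<open>inv e\<close>, which have the same \<open>gp\<close>.\<close>
    then have ax: "axis_form (inv f) {y \<in> carrier G. inv y \<otimes> f \<otimes> y \<in> S} r' \<eta>'"
      "axis_form (inv e) {y \<in> carrier G. inv y \<otimes> e \<otimes> y \<in> S} r \<eta>"
      by (auto intro: axis_form_inv)
    have len: "L (inv f) = L f" "L (inv e) = L e" using G L_inv by auto
    have gp: "gp (inv (inv f)) (inv e) = gp (inv e) f" using G gp_commute[of f "inv e"] by simp
    have "inv f \<otimes> inv e \<otimes> inv (inv f) = inv (inv f \<otimes> e \<otimes> f)"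
      using G by (simp add: inv_mult_group m_assoc)
    then have conj: "L (inv f \<otimes> inv e \<otimes> inv (inv f)) = L (inv f \<otimes> e \<otimes> f)"
      using L_inv[of "inv f \<otimes> e \<otimes> f"] G by simp
    have flip: "inv z \<otimes> y \<in> C" if "inv y \<otimes> z \<in> C" "y \<in> carrier G" "z \<in> carrier G" for y z
      using C_closed(3)[OF that(1)] that(2,3) by (simp add: inv_mult_group)
    show "e \<otimes> f \<in> conjugates S \<or> L (inv f \<otimes> e \<otimes> f) < L e"
      using axis_form_overlap[OF ax] ef(3,4) overlap flip G unfolding len gp conj by fastforce
  qed
qed

text \<open>In the second case \<open>e\<close> fixes the vertex \<open>x (Gi i)\<close>, the
  midpoint of the geodesic from \<open>b\<close> to \<open>e b\<close>.\<close>

definition elliptic_form :: "'a \<Rightarrow> bool" where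
  "elliptic_form e \<longleftrightarrow> e \<in> C \<or>
    (\<exists>x i q. x \<in> carrier G \<and> letter (i, q) \<and> e = x \<otimes> q \<otimes> inv x \<and> L e = 2 * L x + 1)"

lemma elliptic_form_closed: "elliptic_form e \<Longrightarrow> e \<in> carrier G"
  using letter_closed by (force simp: elliptic_form_def)

lemma elliptic_form_inv:
  assumes "elliptic_form e"
  shows "elliptic_form (inv e)"
  using assms unfolding elliptic_form_def
proof (elim disjE exE conjE)
  fix x i q assume x: "x \<in> carrier G" "letter (i, q)" "e = x \<otimes> q \<otimes> inv x" "L e = 2 * L x + 1"
  then have q: "q \<in> carrier G" using letter_closed[of "(i, q)"] by simp
  have "inv e = x \<otimes> inv q \<otimes> inv x"
    using x q by (simp add: inv_mult_group m_assoc)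
  moreover have "L (inv e) = L e" using x q by (intro L_inv) simp
  ultimately show "inv e \<in> C \<or> (\<exists>x i q. x \<in> carrier G \<and> letter (i, q) \<and> inv e = x \<otimes> q \<otimes> inv x \<and>
      L (inv e) = 2 * L x + 1)"
    using x letter_inv by metis
qed simp

text \<open>Parity: a nonzero length is odd here, so \<open>L e < L f = 2 * L x + 1\<close> improves
  to \<open>L e < 2 * L x\<close> unless \<open>e\<close> lies in \<open>C\<close>. Thus
  \<open>x b\<close> lies strictly beyond the midpoint for \<open>e\<close>.\<close>

lemma elliptic_form_overlap:
  assumes "elliptic_form e" "elliptic_form f" "L e < L f" "gp (inv e) f \<ge> L e"
  shows "L (e \<otimes> f \<otimes> inv e) \<le> L f"
    and "gp (inv e) f > L e \<Longrightarrow> L (e \<otimes> f \<otimes> inv e) < L f"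
proof -
  have G: "e \<in> carrier G" "f \<in> carrier G" using assms elliptic_form_closed by auto
  have "f \<notin> C" using assms(3) L_eq_0_iff[OF G(2)] by auto
  then obtain x i q where x: "x \<in> carrier G" "letter (i, q)" "f = x \<otimes> q \<otimes> inv x" "L f = 2 * L x + 1"
    using assms(2) unfolding elliptic_form_def by blast
  have q: "q \<in> carrier G" "L q = 1" using x letter_closed[of "(i, q)"] L_letter by auto
  have "L e = 0 \<or> odd (L e)"
    using assms(1) L_eq_0_iff[OF G(1)] unfolding elliptic_form_def by auto
  then consider "L e = 0" | "L e < 2 * L x" using assms(3) x(4) by (cases "L e = 2 * L x") auto
  moreover have "gp (inv e) f \<le> 2 * int (L e)"
    using gp_le_left[of "inv e" f] G L_inv by simp
  moreover note L_conj_beyond_midpoint[OF G(1) x(1) q(1) x(3) _ assms(4)]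
  ultimately show "L (e \<otimes> f \<otimes> inv e) \<le> L f"
    and "gp (inv e) f > L e \<Longrightarrow> L (e \<otimes> f \<otimes> inv e) < L f"
    using x(4) q(2) by (cases; simp)+
qed

end

section \<open>Nielsen's method for elliptic elements\<close>

locale compatible_subsemigroups = amalgam G I Gi C
  for G :: "('a, 'b) monoid_scheme" (structure) and I :: "'i set" and Gi :: "'i \<Rightarrow> 'a set" and C +
  fixes Q :: "'i \<Rightarrow> 'a set"
  assumes normal: "i \<in> I \<Longrightarrow> normal_subsemigroup G (Gi i) (Q i)"
    and one_notin: "i \<in> I \<Longrightarrow> \<one> \<notin> Q i"
    and compatible: "\<lbrakk>i \<in> I; j \<in> I\<rbrakk> \<Longrightarrow> Q i \<inter> C = Q j \<inter> C"
begin

lemma Q_closed: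
  assumes "i \<in> I"
  shows "q \<in> Q i \<Longrightarrow> q \<in> Gi i" and "q \<in> Q i \<Longrightarrow> q \<in> carrier G"
    and "\<lbrakk>p \<in> Q i; q \<in> Q i\<rbrakk> \<Longrightarrow> p \<otimes> q \<in> Q i"
    and "\<lbrakk>q \<in> Q i; h \<in> Gi i\<rbrakk> \<Longrightarrow> h \<otimes> q \<otimes> inv h \<in> Q i"
proof -
  show "h \<otimes> q \<otimes> inv h \<in> Q i" if "q \<in> Q i" "h \<in> Gi i"
  proof -
    have "inv h \<in> Gi i" "inv (inv h) = h" using that assms Gi_closed by auto
    then show ?thesis using normal[OF assms] that unfolding normal_subsemigroup_def by metis
  qed
qed (use normal[OF assms] Gi_closed(1)[OF assms] in \<open>auto simp: normal_subsemigroup_def\<close>)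

text \<open>Choose the conjugator as short as possible. A last letter in a factor whose
  \<open>Q j\<close> contains the conjugated element could be absorbed by normality. If that element
  lies in \<open>C\<close>, compatibility puts it into every \<open>Q j\<close>, so no letter is
  left; otherwise the last letter has another type and the conjugate is a reduced word.\<close>

lemma conjugates_Q_cases:
  assumes "e \<in> conjugates (\<Union>i\<in>I. Q i)"
  obtains "e \<in> C" "\<And>i. i \<in> I \<Longrightarrow> e \<in> Q i"
  | x i q where "x \<in> carrier G" "i \<in> I" "q \<in> Q i" "letter (i, q)" "e = x \<otimes> q \<otimes> inv x"
      "L e = 2 * L x + 1"
proof -
  define P where "P = (\<lambda>(x, i, q). x \<in> carrier G \<and> i \<in> I \<and> q \<in> Q i \<and> e = x \<otimes> q \<otimes> inv x)"
  have "\<exists>t. P t" using assms by (auto simp: P_def conjugates_def)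
  then obtain x i q where "P (x, i, q)" and min: "\<And>y j p. P (y, j, p) \<Longrightarrow> L x \<le> L y"
    using ex_has_least_nat[of P _ "\<lambda>t. L (fst t)"] by (metis fst_conv prod.exhaust)
  then have x: "x \<in> carrier G" "i \<in> I" "q \<in> Q i" "e = x \<otimes> q \<otimes> inv x"
    by (auto simp: P_def)
  obtain xs c where xs: "word xs" "c \<in> C" "x = val xs \<otimes> c" "L x = length xs"
    using represents_exists[OF x(1)] L_represents by (auto simp: represents_def)
  define p where "p = c \<otimes> q \<otimes> inv c"
  have p: "p \<in> Q i" "p \<in> carrier G" using Q_closed[OF x(2)] x(2,3) xs(2) Gi_closed(4) by (auto simp: p_def)
  have e: "e = val xs \<otimes> p \<otimes> inv (val xs)"
    using x xs Q_closed(2) by (simp add: p_def m_assoc inv_mult_group)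
  have absorb: False
    if "xs = xs' @ [(j, a)]" "p \<in> Q j" for xs' j a
  proof -
    have w: "word xs'" "letter (j, a)" using xs(1) that by (auto simp: word_append word_Cons)
    then have a: "j \<in> I" "a \<in> Gi j" "a \<in> carrier G" using letter_closed[of "(j, a)"] by (auto simp: letter_def)
    have "e = val xs' \<otimes> (a \<otimes> p \<otimes> inv a) \<otimes> inv (val xs')"
      using e p a w word_letters_closed[OF w(1)]
      by (simp add: that(1) list_prod_append m_assoc inv_mult_group del: set_map)
    then have "P (val xs', j, a \<otimes> p \<otimes> inv a)"
      using w a that(2) Q_closed(4) by (simp add: P_def)
    then show False using min xs(4) L_val[OF w(1)] that(1) by fastforce
  qed
  show thesis
  proof (cases "p \<in> C")
    case True
    then have pQ: "p \<in> Q j" if "j \<in> I" for j using compatible[OF x(2) that] p by blast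
    have "xs = []"
    proof (rule ccontr)
      assume "xs \<noteq> []"
      then obtain xs' j a where xs': "xs = xs' @ [(j, a)]" by (metis rev_exhaust prod.exhaust)
      then have "j \<in> I" using xs(1) by (auto simp: word_append word_Cons letter_def)
      then show False using absorb xs' pQ by blast
    qed
    then have "e = p" using e p by simp
    then show thesis using True pQ that(1) by blast
  next
    case False
    then have letter: "letter (i, p)" using p(1) x(2) Q_closed(1) by (simp add: letter_def)
    have "xs = [] \<or> fst (last xs) \<noteq> i"
      using absorb p(1) by (metis append_butlast_last_id prod.collapse)
    then have w: "word (xs @ (i, p) # inv_word xs)"
      using xs(1) letter by (auto simp: word_append word_Cons hd_inv_word)
    have "val (xs @ (i, p) # inv_word xs) = e"
      using e p xs(1) word_letters_closed[OF xs(1)] word_letters_closed[OF word_inv_word[OF xs(1)]]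
      by (simp add: list_prod_append val_inv_word m_assoc del: set_map)
    then have "L e = 2 * L (val xs) + 1" using L_val[OF w] L_val[OF xs(1)] by simp
    then show thesis using that(2)[of "val xs" i p] xs(1) x(2) p letter e by simp
  qed
qed

lemma conjugates_Q_elliptic_form: "e \<in> conjugates (\<Union>i\<in>I. Q i) \<Longrightarrow> elliptic_form e"
  by (erule conjugates_Q_cases) (auto simp: elliptic_form_def)

text \<open>At equal length, an overlap up to the midpoint means a common fixed vertex. Seen from
  there, both elements lie in the same \<open>Q i\<close>.\<close>

lemma conjugates_Q_merge:
  assumes e: "e \<in> conjugates (\<Union>i\<in>I. Q i)" and f: "f \<in> conjugates (\<Union>i\<in>I. Q i)"
    and len: "L e = L f" "gp (inv e) f \<ge> L e"
  shows "e \<otimes> f \<in> conjugates (\<Union>i\<in>I. Q i)"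
proof -
  have G: "e \<in> carrier G" "f \<in> carrier G"
    using e f conjugates_Q_elliptic_form elliptic_form_closed by blast+
  show ?thesis
    using e
  proof (cases rule: conjugates_Q_cases)
    case 1
    then have "L f = 0" using len L_eq_0_iff[OF G(1)] by simp
    have "f \<in> Q i" if "i \<in> I" for i
      using f that \<open>L f = 0\<close> by (cases rule: conjugates_Q_cases) auto
    moreover obtain i where "i \<in> I" using e by (auto simp: conjugates_def)
    ultimately have "e \<otimes> f \<in> (\<Union>i\<in>I. Q i)" using 1 Q_closed(3) by blast
    then show ?thesis using subset_conjugates[of "\<Union>i\<in>I. Q i"] Q_closed(2) by blast
  next
    case (2 x i q)
    have "f \<notin> C" using 2(6) len L_eq_0_iff[OF G(2)] by auto
    then obtain y j p where y: "y \<in> carrier G" "j \<in> I" "p \<in> Q j" "letter (j, p)" "f = y \<otimes> p \<otimes> inv y"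
        "L f = 2 * L y + 1"
      using f by (auto elim: conjugates_Q_cases)
    have qp: "q \<in> carrier G" "p \<in> carrier G" "L q = 1" "L p = 1" "L (inv q) = 1"
      using 2 y Q_closed(2) L_letter L_inv[of q] by auto
    have geo: "on_geodesic u g" "on_geodesic (u \<otimes> s) g" "L (u \<otimes> s) = Suc (L u)"
      if "u \<in> carrier G" "s \<in> carrier G" "L s = 1" "g = u \<otimes> s \<otimes> inv u" "L g = 2 * L u + 1" for u s g
    proof -
      have "L (u \<otimes> s) \<le> L u + 1" "L (s \<otimes> inv u) \<le> 1 + L u" "L g \<le> L (u \<otimes> s) + L u"
        "L g \<le> L u + L (s \<otimes> inv u)"
        using that L_triangle[of u s] L_triangle[of s "inv u"] L_triangle[of "u \<otimes> s" "inv u"]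
          L_triangle[of u "s \<otimes> inv u"] L_inv[of u] by (simp_all add: m_assoc)
      then show "on_geodesic u g" "on_geodesic (u \<otimes> s) g" "L (u \<otimes> s) = Suc (L u)"
        using that L_inv[of u] by (auto simp: on_geodesic_def m_assoc inv_mult_group)
    qed
    have "inv e = x \<otimes> inv q \<otimes> inv x" "L (inv e) = 2 * L x + 1"
      using 2 qp G L_inv[of e] by (simp_all add: m_assoc inv_mult_group)
    note geo_e = geo[OF 2(1) _ qp(5) this]
    note geo_f = geo[OF y(1) qp(2,4) y(5,6)]
    have "L x = L y" using len 2(6) y(6) by simp
    have c: "inv x \<otimes> y \<in> C"
      using on_geodesics_same_coset[OF geo_e(1) geo_f(1)] len 2(6) \<open>L x = L y\<close> qp G by simp
    define c where "c = inv x \<otimes> y"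
    have y_eq: "y = x \<otimes> c" "c \<in> C" using c 2(1) y(1) by (simp_all add: c_def)
    \<comment> \<open>The geodesics to \<open>inv e b\<close> and \<open>f b\<close> agree up to the
      fixed vertices at distance \<open>2 * L x + 1\<close>, so the two factors coincide.\<close>
    have "gp (x \<otimes> inv q) (y \<otimes> p) \<ge> 2 * int (L x) + 1"
      using gp_on_geodesics[OF geo_e(2) geo_f(2)] len 2(6) geo_e(3) geo_f(3) \<open>L x = L y\<close> qp G by simp
    then have "L (inv (x \<otimes> inv q) \<otimes> (y \<otimes> p)) \<le> 1"
      using geo_e(3) geo_f(3) \<open>L x = L y\<close> qp by (simp add: gp_def)
    moreover have "inv (x \<otimes> inv q) \<otimes> (y \<otimes> p) = inv (inv q) \<otimes> c \<otimes> p"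
      using 2(1) qp y_eq by (simp add: m_assoc inv_mult_group)
    ultimately have "i = j"
      using letters_same_index[OF letter_inv[OF 2(4)] y(4) y_eq(2)] by simp
    then have "c \<otimes> p \<otimes> inv c \<in> Q i" using Q_closed(4)[OF y(2,3)] Gi_closed(4)[OF y(2)] y_eq(2) by simp
    then have "q \<otimes> (c \<otimes> p \<otimes> inv c) \<in> (\<Union>i\<in>I. Q i)" using Q_closed(3)[OF 2(2,3)] 2(2) by blast
    moreover have "e \<otimes> f = x \<otimes> (q \<otimes> (c \<otimes> p \<otimes> inv c)) \<otimes> inv x"
      using 2(1,5) y(5) qp y_eq by (simp add: m_assoc inv_mult_group)
    ultimately show ?thesis using conjugatesI[OF 2(1)] by simp
  qed
qed

theorem list_prod_neq_one_elliptic: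
  assumes "set es \<subseteq> conjugates (\<Union>i\<in>I. Q i)" "es \<noteq> []"
  shows "list_prod G es \<noteq> \<one>"
proof (rule list_prod_neq_one_Nielsen[OF _ _ _ _ _ assms])
  let ?S = "conjugates (\<Union>i\<in>I. Q i)"
  have Q: "(\<Union>i\<in>I. Q i) \<subseteq> carrier G" using Q_closed(2) by blast
  note closed = conjugates_closed[OF Q]
  show "?S \<subseteq> carrier G" using closed by blast
  show "\<one> \<notin> ?S"
  proof
    assume one: "\<one> \<in> ?S"
    then obtain i where "i \<in> I" by (auto simp: conjugates_def)
    show False
      using one \<open>i \<in> I\<close> one_notin[of i] L_one by (cases rule: conjugates_Q_cases) auto
  qed
  show "e \<otimes> f \<otimes> inv e \<in> ?S \<and> inv f \<otimes> e \<otimes> f \<in> ?S" if "e \<in> ?S" "f \<in> ?S" for e f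
    using that conjugates_conj[OF Q] closed by blast
  fix e f assume ef: "e \<in> ?S" "f \<in> ?S"
  note form = conjugates_Q_elliptic_form[OF ef(1)] conjugates_Q_elliptic_form[OF ef(2)]
  have G: "e \<in> carrier G" "f \<in> carrier G" using ef closed by auto
  show "e \<otimes> f \<in> ?S \<or> L e < L f \<and> L (e \<otimes> f \<otimes> inv e) \<le> L f"
    if "L e \<le> L f" "int (L e) \<le> gp (inv e) f"
    using that elliptic_form_overlap(1)[OF form] conjugates_Q_merge[OF ef] by (cases "L e = L f") auto
  \<comment> \<open>Inversion again reduces the other alternative to the overlap lemma, now for
    \<open>inv f\<close> and \<open>inv e\<close>.\<close>
  have len: "L (inv f) = L f" "L (inv e) = L e" using G L_inv by auto
  have gp: "gp (inv (inv f)) (inv e) = gp (inv e) f" using G gp_commute[of f "inv e"] by simp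
  have "inv f \<otimes> inv e \<otimes> inv (inv f) = inv (inv f \<otimes> e \<otimes> f)"
    using G by (simp add: inv_mult_group m_assoc)
  then have conj: "L (inv f \<otimes> inv e \<otimes> inv (inv f)) = L (inv f \<otimes> e \<otimes> f)"
    using L_inv[of "inv f \<otimes> e \<otimes> f"] G by simp
  show "e \<otimes> f \<in> ?S \<or> L (inv f \<otimes> e \<otimes> f) < L e"
    if "L f \<le> L e" "int (L f) < gp (inv e) f"
    using that elliptic_form_overlap(2)[OF elliptic_form_inv[OF form(2)] elliptic_form_inv[OF form(1)]]
      conjugates_Q_merge[OF ef]
    unfolding len gp conj by (cases "L e = L f") auto
qed

end

section \<open>Closed walks on a cyclic word\<close>

text \<open>For \<open>k, l < m\<close>, \<open>turn m k l\<close> is the largest integer \<open>X\<close> with \<open>l - k + m X \<le> 1\<close>.\<close>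

definition turn :: "nat \<Rightarrow> nat \<Rightarrow> nat \<Rightarrow> int" where
  "turn m k l = (if Suc k = m \<and> l = 0 then 1 else if Suc k < l then -1 else 0)"

fun turns :: "nat \<Rightarrow> nat list \<Rightarrow> int" where
  "turns m (k # l # ks) = turn m k l + turns m (l # ks)"
| "turns m _ = 0"

text \<open>The total rise of the lifted closed walk, divided by \<open>m\<close>: the differences
  of the tags cancel around the cycle.\<close>

definition winding :: "nat \<Rightarrow> nat list \<Rightarrow> int" where
  "winding m ks = turns m ks + turn m (last ks) (hd ks)"

lemma turn_max:
  assumes "k < m" "l < m" "int l - int k + int m * z \<le> 1"
  shows "z \<le> turn m k l"
proof -
  have "z < 2"
  proof (rule ccontr)
    assume "\<not> z < 2"
    then have "int m * 2 \<le> int m * z" by (intro mult_left_mono) auto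
    then show False using assms by linarith
  qed
  moreover have "z < 1" if "\<not> (Suc k = m \<and> l = 0)"
  proof (rule ccontr)
    assume "\<not> z < 1"
    then have "int m * 1 \<le> int m * z" by (intro mult_left_mono) auto
    then show False using assms that by linarith
  qed
  moreover have "z < 0" if "Suc k < l"
  proof (rule ccontr)
    assume "\<not> z < 0"
    then have "int m * 0 \<le> int m * z" by (intro mult_left_mono) auto
    then show False using assms that by linarith
  qed
  ultimately show ?thesis by (auto simp: turn_def)
qed

lemma turn_le: "\<lbrakk>k < m; l < m; 1 < m\<rbrakk> \<Longrightarrow> int l - int k + int m * turn m k l \<le> 1"
  by (auto simp: turn_def)

text \<open>\<open>turn m k l\<close> is the floor of \<open>(1 + k - l) / m\<close>. Both pairs of
  fractions have the same sum, and the floors of two numbers with given sum add up to one of two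
  consecutive integers.\<close>

lemma turn_exchange:
  "\<lbrakk>a < m; b < m; c < m; d < m; 1 < m\<rbrakk> \<Longrightarrow>
    turn m a d + turn m c b \<le> turn m a b + turn m c d + 1"
  by (auto simp: turn_def)

lemma turns_append:
  "\<lbrakk>ks \<noteq> []; ls \<noteq> []\<rbrakk> \<Longrightarrow>
    turns m (ks @ ls) = turns m ks + turn m (last ks) (hd ls) + turns m ls"
proof (induction ks)
  case (Cons k ks)
  then show ?case by (cases ks; cases ls) auto
qed simp

lemma winding_rotate: "\<lbrakk>ks \<noteq> []; ls \<noteq> []\<rbrakk> \<Longrightarrow> winding m (ks @ ls) = winding m (ls @ ks)"
  by (simp add: winding_def turns_append)

text \<open>Concatenation exchanges the targets of the two closing steps, which loses at most one
  turn; so windings of at least 1 stay at least 1.\<close>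

lemma winding_append_ge:
  assumes "ks \<noteq> []" "ls \<noteq> []" "\<forall>k\<in>set (ks @ ls). k < m" "1 < m"
  shows "winding m ks + winding m ls \<le> winding m (ks @ ls) + 1"
  using turn_exchange[of "last ks" m "hd ls" "last ls" "hd ks"] assms
  by (simp add: winding_def turns_append)

text \<open>A lifted step rises by 1 only to the cyclic successor. Without such steps no step rises,
  and only constant steps are level.\<close>

lemma turns_no_up_step:
  assumes "ks \<noteq> []" "\<forall>k\<in>set ks. k < m"
    and "\<And>k l. \<lbrakk>k \<in> set ks; l \<in> set ks\<rbrakk> \<Longrightarrow> l \<noteq> Suc k \<and> \<not> (Suc k = m \<and> l = 0)"
  shows "int (last ks) - int (hd ks) + int m * turns m ks \<le> 0" (is "?A ks")
    and "int (last ks) - int (hd ks) + int m * turns m ks = 0 \<Longrightarrow> k \<in> set ks \<Longrightarrow> k = hd ks"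
    and "turns m ks \<le> 0"
proof -
  have "?A ks \<and> turns m ks \<le> 0 \<and>
    (int (last ks) - int (hd ks) + int m * turns m ks = 0 \<longrightarrow> (\<forall>k\<in>set ks. k = hd ks))"
    using assms
  proof (induction ks rule: induct_list012)
    case (3 k l ks)
    have "?A (l # ks) \<and> turns m (l # ks) \<le> 0 \<and>
      (int (last (l # ks)) - int (hd (l # ks)) + int m * turns m (l # ks) = 0 \<longrightarrow>
        (\<forall>k\<in>set (l # ks). k = hd (l # ks)))"
      using 3(3-) by (intro 3(2)) auto
    then have IH: "?A (l # ks)" "turns m (l # ks) \<le> 0"
      "int (last (l # ks)) - int l + int m * turns m (l # ks) = 0 \<longrightarrow> (\<forall>k\<in>set ks. k = l)"
      by auto
    have "turn m k l \<le> 0" "int l - int k + int m * turn m k l \<le> 0"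
      "int l - int k + int m * turn m k l = 0 \<longrightarrow> k = l"
      using 3(4) 3(5)[of k l] by (auto simp: turn_def)
    then show ?case
      using IH by (auto simp: distrib_left)
  qed auto
  then show "?A ks" "turns m ks \<le> 0"
    "int (last ks) - int (hd ks) + int m * turns m ks = 0 \<Longrightarrow> k \<in> set ks \<Longrightarrow> k = hd ks"
    by auto
qed

lemma winding_upt: "0 < m \<Longrightarrow> winding m [0..<m] = 1"
proof -
  have *: "turns m [i..<j] = 0" if "j \<le> m" for i j
  proof (induction "j - i" arbitrary: i)
    case (Suc n)
    then have IH: "turns m [Suc i..<j] = 0" by simp
    have "i < j" using Suc by simp
    then show ?case
      using IH that by (cases "Suc i < j") (simp_all add: upt_conv_Cons turn_def)
  qed simp
  assume "0 < m"
  then show ?thesis using *[of m 0] by (simp add: winding_def turn_def)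
qed

lemma successively_constant:
  "successively (\<lambda>x y. f x = f y) xs \<Longrightarrow> x \<in> set xs \<Longrightarrow> f x = f (hd xs)"
proof (induction xs arbitrary: x rule: induct_list012)
  case (3 y z zs)
  have "f y = f z \<and> successively (\<lambda>x y. f x = f y) (z # zs)"
    using 3(3) unfolding successively.simps .
  then show ?case using 3(2)[of x] 3(4) unfolding list.sel set_simps by (metis insertE insertI1)
qed simp_all

section \<open>Positive walks on a cyclically reduced word\<close>

locale cyclic_word = amalgam G I Gi C
  for G :: "('a, 'b) monoid_scheme" (structure) and I :: "'i set" and Gi :: "'i \<Rightarrow> 'a set" and C +
  fixes ws :: "('i \<times> 'a) list"
  assumes word_ws: "word ws" and ws_nonempty: "ws \<noteq> []"
    and cyclic: "fst (hd ws) \<noteq> fst (last ws)"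
    and rtf: "i \<in> I \<Longrightarrow> relatively_torsion_free G C (Gi i)"
begin

abbreviation "m \<equiv> length ws"

definition type_of :: "nat \<Rightarrow> 'i" where "type_of k = fst (ws ! k)"

definition tagged :: "nat \<times> 'a \<Rightarrow> bool" where
  "tagged p \<longleftrightarrow> fst p < m \<and> (\<exists>c\<in>C. \<exists>d\<in>C. snd p = c \<otimes> snd (ws ! fst p) \<otimes> d)"

abbreviation tprod :: "(nat \<times> 'a) list \<Rightarrow> 'a" where
  "tprod l \<equiv> list_prod G (map snd l)"

text \<open>Elements of the double cosets \<open>C w\<^sub>k C\<close>, \<open>w\<^sub>k\<close> the letters of the given word, are tagged with
  \<open>k\<close>. Lift the tags to the integers so that each step goes up by at most one; a positive closed
  walk is one which then ends above its start.\<close>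

definition walk :: "(nat \<times> 'a) list \<Rightarrow> bool" where
  "walk l \<longleftrightarrow> l \<noteq> [] \<and> (\<forall>p\<in>set l. tagged p) \<and> winding m (map fst l) \<ge> 1"

lemma m_gt_1: "1 < m"
  using ws_nonempty cyclic by (cases ws rule: remdups_adj.cases) auto

lemma letter_ws: "k < m \<Longrightarrow> letter (ws ! k)"
  using word_ws nth_mem by (fastforce simp: word_def)

lemma tagged_letter: "tagged p \<Longrightarrow> letter (type_of (fst p), snd p)"
  using letter_ws[of "fst p"] letter_mult_left letter_mult_right
  by (cases "ws ! fst p") (auto simp: tagged_def type_of_def)

lemma tagged_closed: "tagged p \<Longrightarrow> snd p \<in> carrier G"
  using tagged_letter letter_closed by fastforce

lemma tprod_set_closed: "\<forall>p\<in>set l. tagged p \<Longrightarrow> set (map snd l) \<subseteq> carrier G"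
  using tagged_closed by auto

lemma tprod_closed: "\<forall>p\<in>set l. tagged p \<Longrightarrow> tprod l \<in> carrier G"
  using tprod_set_closed by (intro list_prod_closed) auto

lemma tprod_append:
  "\<lbrakk>\<forall>p\<in>set l. tagged p; \<forall>p\<in>set l'. tagged p\<rbrakk> \<Longrightarrow> tprod (l @ l') = tprod l \<otimes> tprod l'"
  using tprod_set_closed by (simp add: list_prod_append)

text \<open>Cyclic neighbours in the word lie in different factors; hence a stretch inside one
  factor cannot rise.\<close>

lemma type_of_up_step:
  assumes "k < m" "l < m" "type_of k = type_of l"
  shows "l \<noteq> Suc k \<and> \<not> (Suc k = m \<and> l = 0)"
proof
  show "l \<noteq> Suc k"
    using assms word_ws distinct_adj_nth[of "map fst ws" k] by (auto simp: word_def type_of_def)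
  show "\<not> (Suc k = m \<and> l = 0)"
  proof
    assume "Suc k = m \<and> l = 0"
    then have "l = 0" "k = m - 1" by auto
    then have "ws ! l = hd ws" "ws ! k = last ws"
      using ws_nonempty by (auto simp: hd_conv_nth last_conv_nth)
    then show False using assms cyclic by (simp add: type_of_def)
  qed
qed

lemma tagged_mult: "\<lbrakk>tagged (k, a); c \<in> C; d \<in> C\<rbrakk> \<Longrightarrow> tagged (k, c \<otimes> a \<otimes> d)"
proof -
  assume a: "tagged (k, a)" "c \<in> C" "d \<in> C"
  then obtain c' d' where "c' \<in> C" "d' \<in> C" "a = c' \<otimes> snd (ws ! k) \<otimes> d'" "k < m"
    by (auto simp: tagged_def)
  moreover have "snd (ws ! k) \<in> carrier G" using letter_ws letter_closed \<open>k < m\<close> by blast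
  moreover have "c \<otimes> a \<otimes> d = (c \<otimes> c') \<otimes> snd (ws ! k) \<otimes> (d' \<otimes> d)"
    using a calculation by (simp add: m_assoc)
  ultimately show ?thesis
    using a C_closed(4) unfolding tagged_def by (metis fst_conv snd_conv)
qed

lemma tagged_list_mult:
  assumes "l \<noteq> []" "\<forall>p\<in>set l. tagged p" "c \<in> C" "d \<in> C"
  shows "\<exists>l'. map fst l' = map fst l \<and> (\<forall>p\<in>set l'. tagged p) \<and> tprod l' = c \<otimes> tprod l \<otimes> d"
  using assms
proof (induction l arbitrary: c)
  case (Cons p l)
  obtain k a where p: "p = (k, a)" by fastforce
  have a: "a \<in> carrier G" "tagged (k, a)" using Cons.prems p tagged_closed by fastforce+
  show ?case
  proof (cases "l = []")
    case True
    then show ?thesis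
      using a p Cons.prems tagged_mult by (intro exI[of _ "[(k, c \<otimes> a \<otimes> d)]"]) auto
  next
    case False
    then obtain l' where l': "map fst l' = map fst l" "\<forall>p\<in>set l'. tagged p"
      "tprod l' = \<one> \<otimes> tprod l \<otimes> d"
      using Cons.IH[of \<one>] Cons.prems by auto
    have "tagged (k, c \<otimes> a)" using tagged_mult[of k a c \<one>] a Cons.prems by simp
    then show ?thesis
      using l' a p Cons.prems tprod_closed[of l] by (intro exI[of _ "(k, c \<otimes> a) # l'"]) (auto simp: m_assoc)
  qed
qed simp

definition walk_products :: "'a set" where
  "walk_products = tprod ` {l. walk l}"

lemma walk_products_closed: "walk_products \<subseteq> carrier G"
  using tprod_closed by (auto simp: walk_products_def walk_def)

lemma walk_products_mult:
  assumes "s \<in> walk_products" "t \<in> walk_products"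
  shows "s \<otimes> t \<in> walk_products"
proof -
  obtain l l' where l: "walk l" "s = tprod l" "walk l'" "t = tprod l'"
    using assms by (auto simp: walk_products_def)
  have "winding m (map fst l) + winding m (map fst l') \<le> winding m (map fst l @ map fst l') + 1"
    using l m_gt_1 by (intro winding_append_ge) (auto simp: walk_def tagged_def)
  then have "walk (l @ l')" using l by (auto simp: walk_def)
  moreover have "s \<otimes> t = tprod (l @ l')" using l by (simp add: tprod_append walk_def del: map_append)
  ultimately show ?thesis unfolding walk_products_def by blast
qed

lemma walk_products_mult_C:
  assumes "walk l" "c \<in> C" "d \<in> C"
  shows "\<exists>l'. length l' = length l \<and> walk l' \<and> tprod l' = c \<otimes> tprod l \<otimes> d"
proof -
  obtain l' where l': "map fst l' = map fst l" "\<forall>p\<in>set l'. tagged p" "tprod l' = c \<otimes> tprod l \<otimes> d"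
    using tagged_list_mult[of l c d] assms by (auto simp: walk_def)
  then have "length l' = length l" using map_eq_imp_length_eq by blast
  then show ?thesis using l' assms(1) by (auto simp: walk_def)
qed

lemma walk_products_conj_C:
  assumes "s \<in> walk_products" "c \<in> C"
  shows "c \<otimes> s \<otimes> inv c \<in> walk_products"
proof -
  obtain l where l: "walk l" "s = tprod l" using assms by (auto simp: walk_products_def)
  then obtain l' where "walk l'" "tprod l' = c \<otimes> s \<otimes> inv c"
    using walk_products_mult_C[of l c "inv c"] assms(2) by auto
  then show ?thesis unfolding walk_products_def by (metis imageI mem_Collect_eq)
qed

text \<open>Up to a left factor in \<open>C\<close>, such a product has the form
  \<open>w h1 ... w hn\<close> with \<open>w\<close> the letter at \<open>k\<close>, and relative
  torsion-freeness applies to it.\<close>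

lemma tprod_constant_notin_C:
  assumes "l \<noteq> []" "\<forall>p\<in>set l. tagged p \<and> fst p = k"
  shows "tprod l \<notin> C"
proof
  assume prod: "tprod l \<in> C"
  let ?w = "snd (ws ! k)"
  have k: "k < m" using assms by (cases l) (auto simp: tagged_def)
  then have w: "fst (ws ! k) \<in> I" "?w \<in> Gi (fst (ws ! k)) - C" "?w \<in> carrier G"
    using letter_ws letter_closed by (auto simp: letter_def)
  have "\<exists>hs c. hs \<noteq> [] \<and> set hs \<subseteq> C \<and> c \<in> C \<and> tprod l = c \<otimes> list_prod G (map ((\<otimes>) ?w) hs)"
    using assms
  proof (induction l)
    case (Cons p l)
    obtain c d where p: "c \<in> C" "d \<in> C" "snd p = c \<otimes> ?w \<otimes> d"
      using Cons.prems by (auto simp: tagged_def)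
    show ?case
    proof (cases "l = []")
      case True
      then show ?thesis using p w by (intro exI[of _ "[d]"] exI[of _ c]) (auto simp: m_assoc)
    next
      case False
      then obtain hs c' where hs: "hs \<noteq> []" "set hs \<subseteq> C" "c' \<in> C"
        "tprod l = c' \<otimes> list_prod G (map ((\<otimes>) ?w) hs)"
        using Cons by auto
      then have "set (map ((\<otimes>) ?w) hs) \<subseteq> carrier G" using w by auto
      then show ?thesis
        using hs p w list_prod_closed[of "map ((\<otimes>) ?w) hs"]
        by (intro exI[of _ "(d \<otimes> c') # hs"] exI[of _ c]) (auto simp: m_assoc)
    qed
  qed simp
  then obtain hs c where hs: "hs \<noteq> []" "set hs \<subseteq> C" "c \<in> C"
    "tprod l = c \<otimes> list_prod G (map ((\<otimes>) ?w) hs)" by blast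
  have hsG: "set (map ((\<otimes>) ?w) hs) \<subseteq> carrier G" using hs w by auto
  define d where "d = list_prod G (map ((\<otimes>) ?w) hs)"
  have d: "d \<in> C" "d \<in> carrier G"
    using prod hs C_mult_iff(1)[of c d] list_prod_closed[OF hsG] by (auto simp: d_def)
  \<comment> \<open>If the product is \<open>d\<close> in \<open>C\<close>, multiplying the last
    \<open>h\<close> by \<open>inv d\<close> turns it into 1.\<close>
  obtain hs' h where hs': "hs = hs' @ [h]" using hs(1) by (metis rev_exhaust)
  have h: "h \<in> C" "set hs' \<subseteq> C" using hs hs' by auto
  have hs'G: "set (map ((\<otimes>) ?w) hs') \<subseteq> carrier G" using h w by auto
  let ?v = "list_prod G (map ((\<otimes>) ?w) hs')"
  have "d = ?v \<otimes> (?w \<otimes> h)"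
    using h hs'G w unfolding d_def hs' by (simp add: list_prod_append del: set_map)
  moreover have "list_prod G (map ((\<otimes>) ?w) (hs' @ [h \<otimes> inv d])) = ?v \<otimes> (?w \<otimes> h) \<otimes> inv d"
    using h hs'G w d list_prod_closed[OF hs'G] by (simp add: list_prod_append m_assoc del: set_map)
  ultimately have "list_prod G (map ((\<otimes>) ?w) (hs' @ [h \<otimes> inv d])) = d \<otimes> inv d" by metis
  then have "list_prod G (map ((\<otimes>) ?w) (hs' @ [h \<otimes> inv d])) = \<one>" using d by simp
  moreover have "set (hs' @ [h \<otimes> inv d]) \<subseteq> C" using h d by auto
  ultimately show False
    using rtf[OF w(1)] w(2) unfolding relatively_torsion_free_def by blast
qed

text \<open>A piece of a walk with letters of a single type and product in \<open>C\<close> can be cut out: it is not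
  constant, so it goes down, and this makes up for the step across the gap.\<close>

lemma walk_shorten:
  assumes "walk (r @ l)" "r \<noteq> []" "l \<noteq> []" "\<forall>p\<in>set r. type_of (fst p) = t" "tprod r \<in> C"
  shows "\<exists>l'. length l' = length l \<and> walk l' \<and> tprod l' = tprod (r @ l)"
proof -
  have tag: "\<forall>p\<in>set r. tagged p" "\<forall>p\<in>set l. tagged p" using assms(1) by (auto simp: walk_def)
  let ?r = "map fst r" and ?l = "map fst l"
  have less: "\<forall>k\<in>set ?r. k < m" "\<forall>k\<in>set ?l. k < m" using tag by (auto simp: tagged_def)
  have no_up: "j \<noteq> Suc k \<and> \<not> (Suc k = m \<and> j = 0)" if "k \<in> set ?r" "j \<in> set ?r" for k j
  proof -
    have "type_of k = type_of j" using that assms(4) by (metis image_iff set_map)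
    then show ?thesis using type_of_up_step that less(1) by blast
  qed
  note down = turns_no_up_step[OF _ less(1) no_up]
  have "int (last ?r) - int (hd ?r) + int m * turns m ?r \<noteq> 0"
  proof
    assume "int (last ?r) - int (hd ?r) + int m * turns m ?r = 0"
    then have "\<forall>p\<in>set r. tagged p \<and> fst p = hd ?r" using down(2) assms(2) tag by auto
    then show False using tprod_constant_notin_C assms(2,5) by blast
  qed
  then have "int (last ?r) - int (hd ?r) + int m * turns m ?r \<le> -1"
    using down(1) assms(2) by simp
  moreover have mem: "last ?l < m" "hd ?r < m" "last ?r < m" "hd ?l < m"
    using less assms(2,3) by (metis hd_in_set last_in_set map_is_Nil_conv)+
  then have "int (hd ?r) - int (last ?l) + int m * turn m (last ?l) (hd ?r) \<le> 1"
    "int (hd ?l) - int (last ?r) + int m * turn m (last ?r) (hd ?l) \<le> 1"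
    using turn_le m_gt_1 by blast+
  \<comment> \<open>The two seam steps rise by at most 1 each and the piece falls by at least 1.
    Together they rise by at most 1, so maximality of \<open>turn\<close> applies to the direct
    step.\<close>
  ultimately have "turn m (last ?l) (hd ?r) + turns m ?r + turn m (last ?r) (hd ?l) \<le>
      turn m (last ?l) (hd ?l)"
    using mem by (intro turn_max) (simp_all add: distrib_left)
  moreover have "winding m (map fst (r @ l)) \<ge> 1" using assms(1) by (simp add: walk_def)
  ultimately have "winding m ?l \<ge> 1"
    using assms(2,3) by (simp add: winding_def turns_append)
  then have "walk l" using assms(3) tag by (simp add: walk_def)
  \<comment> \<open>The product of the removed piece lies in \<open>C\<close> and is absorbed by the
    first remaining element, whose tag it does not change.\<close>
  then obtain l' where l': "length l' = length l" "walk l'" "tprod l' = tprod r \<otimes> tprod l \<otimes> \<one>"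
    using walk_products_mult_C[of l "tprod r" \<one>] assms(5) by auto
  moreover have "tprod r \<otimes> tprod l \<otimes> \<one> = tprod (r @ l)"
    using tag tprod_closed[of l] assms(5) by (simp add: tprod_append del: map_append)
  ultimately show ?thesis by metis
qed

text \<open>Within one factor no step rises, the closing one included, so the winding cannot be
  positive.\<close>

lemma walk_not_single_type:
  assumes "walk l"
  shows "\<not> (\<forall>p\<in>set l. type_of (fst p) = t)"
proof
  assume t: "\<forall>p\<in>set l. type_of (fst p) = t"
  let ?l = "map fst l"
  have less: "\<forall>k\<in>set ?l. k < m" "?l \<noteq> []" using assms by (auto simp: walk_def tagged_def)
  have no_up: "j \<noteq> Suc k \<and> \<not> (Suc k = m \<and> j = 0)" if "k \<in> set ?l" "j \<in> set ?l" for k j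
  proof -
    have "type_of k = type_of j" using that t by (metis image_iff set_map)
    then show ?thesis using type_of_up_step that less(1) by blast
  qed
  have "turns m ?l \<le> 0" using turns_no_up_step(3)[OF less(2,1) no_up] by blast
  moreover have "turn m (last ?l) (hd ?l) \<le> 0"
  proof -
    have "last ?l \<in> set ?l" "hd ?l \<in> set ?l" using less(2) by (metis last_in_set, metis hd_in_set)
    then have "\<not> (Suc (last ?l) = m \<and> hd ?l = 0)" using no_up by blast
    then show ?thesis unfolding turn_def by simp
  qed
  ultimately show False using assms by (simp add: walk_def winding_def)
qed

text \<open>Multiply out the maximal runs of one type: each product lies in a factor but not in
  \<open>C\<close>, so it is a letter, and adjacent runs have different types.\<close>

lemma tagged_list_word:
  assumes "l \<noteq> []" "\<forall>p\<in>set l. tagged p"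
    and "\<forall>a r b t. l = a @ r @ b \<longrightarrow> r \<noteq> [] \<longrightarrow> (\<forall>p\<in>set r. type_of (fst p) = t) \<longrightarrow> tprod r \<notin> C"
  shows "\<exists>bs. word bs \<and> bs \<noteq> [] \<and> val bs = tprod l \<and> fst (hd bs) = type_of (fst (hd l)) \<and>
    fst (last bs) = type_of (fst (last l)) \<and>
    (\<forall>us vs. bs = us @ vs \<longrightarrow> (\<exists>l1 l2. l = l1 @ l2 \<and> val us = tprod l1))"
  using assms
proof (induction l rule: length_induct)
  case (1 l)
  define t where "t = type_of (fst (hd l))"
  define r where "r = takeWhile (\<lambda>p. type_of (fst p) = t) l"
  define l' where "l' = dropWhile (\<lambda>p. type_of (fst p) = t) l"
  have l: "l = r @ l'" by (simp add: r_def l'_def)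
  have r: "r \<noteq> []" "\<forall>p\<in>set r. type_of (fst p) = t"
    using 1(2) by (cases l; auto simp: r_def t_def dest: set_takeWhileD)+
  have tag: "\<forall>p\<in>set r. tagged p" "\<forall>p\<in>set l'. tagged p" using 1(3) l by auto
  have "tprod r \<notin> C" using 1(4) r l append_Nil by metis
  moreover have "letter (t, hd (map snd r))"
    using tagged_letter tag(1) r by (cases r) auto
  then have "t \<in> I" by (simp add: letter_def)
  moreover have "set (map snd r) \<subseteq> Gi t"
    using tagged_letter tag(1) r by (force simp: letter_def)
  then have "tprod r \<in> Gi t" using list_prod_in_subgroup subgroup_Gi \<open>t \<in> I\<close> by blast
  ultimately have letter: "letter (t, tprod r)" by (simp add: letter_def)
  have rG: "tprod r \<in> carrier G" using tag tprod_closed by blast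
  show ?case
  proof (cases "l' = []")
    case True
    then have "l = r" using l by simp
    have "\<exists>l1 l2. r = l1 @ l2 \<and> \<one> = tprod l1" "\<exists>l1 l2. r = l1 @ l2 \<and> tprod r = tprod l1"
      by (rule exI[of _ "[]"], simp) (rule exI[of _ r], simp)
    then show ?thesis
      using letter r rG \<open>l = r\<close> unfolding t_def[symmetric]
      by (intro exI[of _ "[(t, tprod r)]"]) (auto simp: word_Cons Cons_eq_append_conv)
  next
    case False
    have "\<exists>bs. word bs \<and> bs \<noteq> [] \<and> val bs = tprod l' \<and> fst (hd bs) = type_of (fst (hd l')) \<and>
      fst (last bs) = type_of (fst (last l')) \<and>
      (\<forall>us vs. bs = us @ vs \<longrightarrow> (\<exists>l1 l2. l' = l1 @ l2 \<and> val us = tprod l1))"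
    proof (rule 1(1)[THEN spec, THEN mp, THEN mp, THEN mp, THEN mp])
      show "length l' < length l" using l r by simp
      show "\<forall>a r b t. l' = a @ r @ b \<longrightarrow> r \<noteq> [] \<longrightarrow> (\<forall>p\<in>set r. type_of (fst p) = t) \<longrightarrow> tprod r \<notin> C"
        using 1(4) l append_assoc by metis
    qed (use False tag in auto)
    then obtain bs where bs: "word bs" "bs \<noteq> []" "val bs = tprod l'" "fst (hd bs) = type_of (fst (hd l'))"
      "fst (last bs) = type_of (fst (last l'))"
      "\<And>us vs. bs = us @ vs \<Longrightarrow> \<exists>l1 l2. l' = l1 @ l2 \<and> val us = tprod l1" by blast
    have "type_of (fst (hd l')) \<noteq> t"
      using False hd_dropWhile[of "\<lambda>p. type_of (fst p) = t" l] by (simp add: l'_def)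
    then have "word ((t, tprod r) # bs)" using bs letter by (auto simp: word_Cons)
    moreover have "val ((t, tprod r) # bs) = tprod l" using bs(3) l tag by (simp add: tprod_append del: map_append)
    moreover have "\<exists>l1 l2. l = l1 @ l2 \<and> val us = tprod l1" if us: "(t, tprod r) # bs = us @ vs" for us vs
    proof (cases us)
      case Nil
      then have "l = [] @ l \<and> val us = tprod []" by simp
      then show ?thesis by blast
    next
      case (Cons u us')
      then obtain l1 l2 where "l' = l1 @ l2" "val us' = tprod l1" using us bs(6)[of us' vs] by auto
      moreover have "u = (t, tprod r)" using Cons us by simp
      ultimately show ?thesis
        using l tag Cons by (intro exI[of _ "r @ l1"] exI[of _ l2]) (simp add: tprod_append del: map_append)
    qed
    ultimately show ?thesis
      using bs(2,5) False l unfolding t_def[symmetric]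
      by (intro exI[of _ "(t, tprod r) # bs"]) auto
  qed
qed

lemma walk_rotate:
  assumes "walk (l @ l')"
  shows "walk (l' @ l)" and "tprod (l' @ l) = inv (tprod l) \<otimes> tprod (l @ l') \<otimes> tprod l"
proof -
  have tag: "\<forall>p\<in>set l. tagged p" "\<forall>p\<in>set l'. tagged p" using assms by (auto simp: walk_def)
  show "walk (l' @ l)"
    using assms winding_rotate[of "map fst l" "map fst l'"]
    by (cases "l = [] \<or> l' = []") (auto simp: walk_def)
  show "tprod (l' @ l) = inv (tprod l) \<otimes> tprod (l @ l') \<otimes> tprod l"
    using tag tprod_closed by (simp add: tprod_append m_assoc del: map_append)
qed

text \<open>Take the shortest positive walk with product conjugate to \<open>e\<close>. By
  \<open>walk_shorten\<close> and rotation, no run of one type multiplies into \<open>C\<close>, so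
  the walk collapses to a cyclically reduced word.\<close>

lemma walk_axis_form:
  assumes "e \<in> conjugates walk_products"
  shows "\<exists>r \<eta>. axis_form e {y \<in> carrier G. inv y \<otimes> e \<otimes> y \<in> walk_products} r \<eta>"
proof -
  let ?Y = "{y \<in> carrier G. inv y \<otimes> e \<otimes> y \<in> walk_products}"
  define P where "P = (\<lambda>(x, l). x \<in> carrier G \<and> walk l \<and> e = x \<otimes> tprod l \<otimes> inv x)"
  have "\<exists>p. P p" using assms by (auto simp: conjugates_def walk_products_def P_def)
  then obtain x l where "P (x, l)" and min: "\<And>y l'. P (y, l') \<Longrightarrow> length l \<le> length l'"
    using ex_has_least_nat[of P _ "\<lambda>p. length (snd p)"] by (metis snd_conv prod.exhaust)
  have rotate: "P (y \<otimes> tprod l1, l2 @ l1)" if "P (y, l1 @ l2)" for y l1 l2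
  proof -
    have y: "y \<in> carrier G" "walk (l1 @ l2)" "e = y \<otimes> tprod (l1 @ l2) \<otimes> inv y"
      using that by (auto simp: P_def)
    then have tag: "\<forall>p\<in>set l1. tagged p" "\<forall>p\<in>set (l1 @ l2). tagged p" by (auto simp: walk_def)
    note closed = tprod_closed[OF tag(1)] tprod_closed[OF tag(2)]
    have "e = (y \<otimes> tprod l1) \<otimes> tprod (l2 @ l1) \<otimes> inv (y \<otimes> tprod l1)"
      unfolding walk_rotate(2)[OF y(2)] using y(1) closed
      by (simp add: y(3) m_assoc inv_mult_group del: map_append)
    then show ?thesis using y closed walk_rotate(1) by (simp add: P_def)
  qed
  \<comment> \<open>Rotating to a change of type keeps the first and last run from merging
    cyclically.\<close>
  have "\<exists>y l'. P (y, l') \<and> length l' = length l \<and> type_of (fst (hd l')) \<noteq> type_of (fst (last l'))"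
  proof -
    have "walk l" using \<open>P (x, l)\<close> by (simp add: P_def)
    then have "\<not> successively (\<lambda>p q. type_of (fst p) = type_of (fst q)) l"
      using walk_not_single_type[of l "type_of (fst (hd l))"]
        successively_constant[of "\<lambda>p. type_of (fst p)" l] by blast
    then obtain as p q bs where l: "l = (as @ [p]) @ q # bs" "type_of (fst p) \<noteq> type_of (fst q)"
      by (rule not_successivelyE) auto
    then have "P (x \<otimes> tprod (as @ [p]), (q # bs) @ as @ [p])"
      using rotate[of x "as @ [p]" "q # bs"] \<open>P (x, l)\<close> by simp
    then show ?thesis
      using l by (intro exI[of _ "x \<otimes> tprod (as @ [p])"] exI[of _ "(q # bs) @ as @ [p]"]) auto
  qed
  then obtain y l' where y: "P (y, l')" "length l' = length l"
    "type_of (fst (hd l')) \<noteq> type_of (fst (last l'))" by blast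
  have walk: "walk l'" "y \<in> carrier G" "e = y \<otimes> tprod l' \<otimes> inv y" using y(1) by (auto simp: P_def)
  have tag: "\<forall>p\<in>set l'. tagged p" "l' \<noteq> []" using walk(1) by (auto simp: walk_def)
  have run: "tprod r \<notin> C" if r: "l' = a @ r @ b" "r \<noteq> []" "\<forall>p\<in>set r. type_of (fst p) = t" for a r b t
  proof
    assume C: "tprod r \<in> C"
    have P: "P (y \<otimes> tprod a, r @ b @ a)" using rotate[of y a "r @ b"] y(1) r(1) by simp
    \<comment> \<open>The run is not the whole walk, whose ends have different types.\<close>
    have "b @ a \<noteq> []"
    proof
      assume "b @ a = []"
      then have "l' = r" using r(1) by simp
      then show False using y(3) r(2,3) by simp
    qed
    then obtain l'' where l'': "length l'' = length (b @ a)" "walk l''" "tprod l'' = tprod (r @ b @ a)"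
      using walk_shorten[of r "b @ a" t] r(2,3) C P by (auto simp: P_def)
    then have "P (y \<otimes> tprod a, l'')" using P unfolding P_def by simp
    then show False using min[of "y \<otimes> tprod a" l''] l''(1) r(1,2) y(2) by (cases r) auto
  qed
  have "\<forall>a r b t. l' = a @ r @ b \<longrightarrow> r \<noteq> [] \<longrightarrow> (\<forall>p\<in>set r. type_of (fst p) = t) \<longrightarrow> tprod r \<notin> C"
    using run by blast
  from tagged_list_word[OF tag(2,1) this] obtain bs where
    bs: "word bs" "bs \<noteq> []" "val bs = tprod l'" "fst (hd bs) = type_of (fst (hd l'))"
      "fst (last bs) = type_of (fst (last l'))"
      "\<And>us vs. bs = us @ vs \<Longrightarrow> \<exists>l1 l2. l' = l1 @ l2 \<and> val us = tprod l1"
    by blast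
  \<comment> \<open>From each prefix, \<open>e\<close> is seen as a rotation of the walk, which is
    again positive.\<close>
  have "y \<otimes> val us \<in> ?Y" if us: "bs = us @ vs" for us vs
  proof -
    obtain l1 l2 where l1: "l' = l1 @ l2" "val us = tprod l1" using bs(6)[OF us] by blast
    then have "P (y \<otimes> val us, l2 @ l1)" using rotate y(1) by simp
    then have P: "y \<otimes> val us \<in> carrier G" "walk (l2 @ l1)"
      "e = (y \<otimes> val us) \<otimes> tprod (l2 @ l1) \<otimes> inv (y \<otimes> val us)"
      by (simp_all add: P_def)
    moreover have "tprod (l2 @ l1) \<in> carrier G" using P(2) by (intro tprod_closed) (auto simp: walk_def)
    ultimately have "inv (y \<otimes> val us) \<otimes> e \<otimes> (y \<otimes> val us) = tprod (l2 @ l1)"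
      by (simp add: m_assoc del: map_append)
    then show ?thesis using P(1,2) unfolding walk_products_def by blast
  qed
  then have "axis_word e ?Y y bs"
    unfolding axis_word_def using bs y(3) walk by auto
  moreover have eG: "e \<in> carrier G" using assms conjugates_closed walk_products_closed by blast
  have "z \<otimes> d \<in> ?Y" if "z \<in> ?Y" "d \<in> C" for z d
  proof -
    have "inv d \<otimes> (inv z \<otimes> e \<otimes> z) \<otimes> inv (inv d) \<in> walk_products"
      using that by (intro walk_products_conj_C) auto
    then show ?thesis using that eG by (simp add: m_assoc inv_mult_group)
  qed
  moreover have "e \<otimes> z \<in> ?Y \<and> inv e \<otimes> z \<in> ?Y" if "z \<in> ?Y" for z
  proof -
    have "inv (e \<otimes> z) \<otimes> e \<otimes> (e \<otimes> z) = inv z \<otimes> e \<otimes> z"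
      "inv (inv e \<otimes> z) \<otimes> e \<otimes> (inv e \<otimes> z) = inv z \<otimes> e \<otimes> z"
      using that eG by (simp_all add: m_assoc inv_mult_group)
    then show ?thesis using that eG by simp
  qed
  ultimately show ?thesis by (rule axis_form_exists) auto
qed

theorem not_generalized_torsion:
  assumes "g \<in> conjugates {val ws}"
  shows "\<not> generalized_torsion G g"
proof (rule not_generalized_torsion_conjugates[OF walk_products_closed])
  \<comment> \<open>The word itself, tagged by positions, winds around exactly once.\<close>
  let ?l = "zip [0..<m] (map snd ws)"
  have "tagged p" if p: "p \<in> set ?l" for p
  proof -
    obtain k where "k < m" "p = (k, snd (ws ! k))" using p by (force simp: in_set_zip)
    moreover have "snd (ws ! k) \<in> carrier G" using \<open>k < m\<close> letter_ws letter_closed by blast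
    ultimately show ?thesis
      by (auto simp: tagged_def intro!: bexI[of _ \<one>])
  qed
  then have "walk ?l" using winding_upt[of m] ws_nonempty by (auto simp: walk_def)
  moreover have "tprod ?l = val ws" by simp
  ultimately have "val ws \<in> walk_products" by (force simp: walk_products_def)
  then show "g \<in> conjugates walk_products" using assms by (auto simp: conjugates_def)
  show "list_prod G es \<noteq> \<one>" if "set es \<subseteq> conjugates walk_products" "es \<noteq> []" for es
    using that walk_products_mult walk_products_conj_C walk_axis_form walk_products_closed
    by (intro list_prod_neq_one_hyperbolic[of walk_products])
qed

end

section \<open>The main theorem\<close>

context amalgam
begin

lemma conjugates_sym:
  assumes "h \<in> carrier G" "g \<in> conjugates {h}"
  shows "h \<in> conjugates {g}"
proof -
  obtain x where x: "x \<in> carrier G" "g = x \<otimes> h \<otimes> inv x" using assms by (auto simp: conjugates_def)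
  then have "h = inv x \<otimes> g \<otimes> inv (inv x)" using assms(1) by (simp add: m_assoc)
  then show ?thesis using x(1) conjugatesI[of "inv x" g "{g}"] by simp
qed

text \<open>In a conjugate of least length, first and last letters from the same factor are
  excluded: moving the first letter to the end would merge the two.\<close>

lemma conjugate_into_factor_or_cyclic:
  assumes "g \<in> carrier G"
  obtains i h where "i \<in> I" "h \<in> Gi i" "g \<in> conjugates {h}"
  | ws where "word ws" "ws \<noteq> []" "fst (hd ws) \<noteq> fst (last ws)" "g \<in> conjugates {val ws}"
proof -
  obtain h where h: "h \<in> conjugates {g}" and min: "\<And>y. y \<in> conjugates {g} \<Longrightarrow> L h \<le> L y"
    using ex_has_least_nat[of "\<lambda>y. y \<in> conjugates {g}" g L] subset_conjugates[of "{g}"] assms by auto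
  have hG: "h \<in> carrier G" using h assms by (auto simp: conjugates_def)
  have gh: "g \<in> conjugates {h}" using conjugates_sym[OF assms h] .
  obtain ws c where ws: "word ws" "c \<in> C" "h = val ws \<otimes> c" "L h = length ws"
    using represents_exists[OF hG] L_represents by (auto simp: represents_def)
  show thesis
  proof (cases ws rule: rev_cases)
    case Nil
    obtain i where "i \<in> I" using amalgamated by (auto simp: amalgamated_free_product_def)
    then show thesis using that(1) gh ws Nil Gi_closed(4) by auto
  next
    case (snoc us p)
    obtain j b where p: "p = (j, b)" by fastforce
    have us: "word us" "letter (j, b)" "us = [] \<or> fst (last us) \<noteq> j"
      using ws(1) by (auto simp: snoc p word_append word_Cons)
    have b: "b \<in> carrier G" "j \<in> I" "letter (j, b \<otimes> c)" "b \<otimes> c \<in> Gi j"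
      using us(2) ws(2) letter_closed[of "(j, b)"] letter_mult_right by (auto simp: letter_def Gi_closed)
    let ?vs = "us @ [(j, b \<otimes> c)]"
    have vs: "word ?vs" "h = val ?vs"
      using us b ws word_letters_closed[OF us(1)]
      by (auto simp: word_append word_Cons snoc p list_prod_append m_assoc simp del: set_map)
    show thesis
    proof (cases us)
      case Nil
      then show thesis using that(1)[of j "b \<otimes> c"] gh vs(2) b ws(2) by simp
    next
      case (Cons q us')
      obtain i a where q: "q = (i, a)" by fastforce
      have a: "letter (i, a)" "a \<in> carrier G" "word us'"
        using us(1) letter_closed[of "(i, a)"] by (auto simp: Cons q word_Cons)
      have "i \<noteq> j"
      proof
        assume "i = j"
        let ?w = "us' @ [(j, b \<otimes> c \<otimes> a)]"
        have "inv a \<otimes> h \<otimes> a = val ?w"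
          using vs(2) a b ws(2) word_letters_closed[OF a(3)]
          by (simp add: Cons q list_prod_append m_assoc del: set_map)
        moreover have "L (val ?w) \<le> length ?w"
          using a b \<open>i = j\<close> by (intro L_val_le) (auto simp: letter_def word_def Gi_closed)
        moreover have "inv a \<otimes> h \<otimes> a \<in> conjugates {g}"
          using conjugates_conj(2)[of "{g}" h a] assms h a(2) by simp
        ultimately show False using min[of "inv a \<otimes> h \<otimes> a"] ws(4) by (simp add: snoc Cons)
      qed
      then show thesis using that(2)[of ?vs] vs gh by (simp add: Cons q)
    qed
  qed
qed

theorem no_generalized_torsion_in_factors:
  assumes "\<forall>i\<in>I. \<forall>P\<in>F i. normal_subsemigroup G (Gi i) P"
    and "\<forall>i\<in>I. Gi i - {\<one>} = \<Union>(F i)"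
    and "\<forall>i\<in>I. \<forall>j\<in>I. \<forall>P\<in>F i. \<exists>Q\<in>F j. P \<inter> C = Q \<inter> C"
    and h: "i \<in> I" "h \<in> Gi i" and g: "g \<in> conjugates {h}"
  shows "\<not> generalized_torsion G g"
proof (cases "h = \<one>")
  case True
  then have "g = \<one>" using g by (auto simp: conjugates_def)
  then show ?thesis by (simp add: generalized_torsion_def)
next
  case False
  then obtain P where P: "P \<in> F i" "h \<in> P" using assms(2) h by blast
  then have "\<forall>j\<in>I. \<exists>Q\<in>F j. P \<inter> C = Q \<inter> C" using assms(3) h by blast
  then obtain Q where Q: "\<forall>j\<in>I. Q j \<in> F j \<and> P \<inter> C = Q j \<inter> C" by metis
  \<comment> \<open>The choice at the index \<open>i\<close> itself need not contain
    \<open>h\<close>, so it is replaced by \<open>P\<close>.\<close>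
  define R where "R = Q(i := P)"
  have R: "R j \<in> F j" "P \<inter> C = R j \<inter> C" if "j \<in> I" for j
    using Q P that by (auto simp: R_def)
  interpret compatible_subsemigroups G I Gi C R
  proof
    show "\<one> \<notin> R j" if "j \<in> I" for j using assms(2) R(1)[OF that] that by blast
    show "R j \<inter> C = R k \<inter> C" if "j \<in> I" "k \<in> I" for j k using R(2)[OF that(1)] R(2)[OF that(2)] by simp
  qed (use R(1) assms(1) in blast)
  have "h \<in> (\<Union>j\<in>I. R j)" using P h by (auto simp: R_def)
  then have "g \<in> conjugates (\<Union>j\<in>I. R j)" using g by (auto simp: conjugates_def)
  moreover have "(\<Union>j\<in>I. R j) \<subseteq> carrier G" using Q_closed(2) by blast
  ultimately show ?thesis
    using not_generalized_torsion_conjugates list_prod_neq_one_elliptic by blast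
qed

theorem generalized_torsion_free_amalgam:
  assumes "\<forall>i\<in>I. \<forall>P\<in>F i. normal_subsemigroup G (Gi i) P"
    and "\<forall>i\<in>I. Gi i - {\<one>} = \<Union>(F i)"
    and "\<forall>i\<in>I. \<forall>j\<in>I. \<forall>P\<in>F i. \<exists>Q\<in>F j. P \<inter> C = Q \<inter> C"
    and rtf: "\<forall>i\<in>I. relatively_torsion_free G C (Gi i)"
  shows "generalized_torsion_free G"
  unfolding generalized_torsion_free_def
proof
  fix g assume "g \<in> carrier G"
  then show "\<not> generalized_torsion G g"
  proof (cases rule: conjugate_into_factor_or_cyclic)
    case (1 i h)
    then show ?thesis using no_generalized_torsion_in_factors[OF assms(1-3)] by blast
  next
    case (2 ws)
    interpret cyclic_word G I Gi C ws
      using 2 rtf by unfold_locales auto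
    show ?thesis using not_generalized_torsion 2(4) .
  qed
qed

text \<open>The subsemigroups are the traces on \<open>Gi i\<close> of the normal subsemigroups of \<open>G\<close> generated by
  single elements.\<close>

theorem compatible_families_exist:
  assumes "\<forall>g\<in>(\<Union>i\<in>I. Gi i). \<not> generalized_torsion G g"
  shows "\<exists>F. (\<forall>i\<in>I. \<forall>P\<in>F i. normal_subsemigroup G (Gi i) P) \<and>
    (\<forall>i\<in>I. Gi i - {\<one>} = \<Union>(F i)) \<and>
    (\<forall>i\<in>I. \<forall>j\<in>I. \<forall>P\<in>F i. \<exists>Q\<in>F j. P \<inter> C = Q \<inter> C)"
proof -
  define N where "N g = {list_prod G (map (conj_by G g) hs) | hs. hs \<noteq> [] \<and> set hs \<subseteq> carrier G}" for g
  define A where "A = (\<Union>i\<in>I. Gi i) - {\<one>}"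
  \<comment> \<open>Every \<open>g\<close> from any factor contributes to every \<open>F i\<close>,
    so that the same \<open>N g\<close> supplies the partner in \<open>F j\<close>; its trace on a
    factor may be empty.\<close>
  define F where "F i = (\<lambda>g. N g \<inter> Gi i) ` A" for i
  have A: "g \<in> carrier G" if "g \<in> A" for g using that Gi_closed(1) by (auto simp: A_def)
  have conj_closed: "conj_by G g h \<in> carrier G" if "g \<in> A" "h \<in> carrier G" for g h
    using A that by (simp add: conj_by_def)
  have one: "\<one> \<notin> N g" if "g \<in> A" for g
  proof
    assume "\<one> \<in> N g"
    then obtain hs where "hs \<noteq> []" "set hs \<subseteq> carrier G" "list_prod G (map (conj_by G g) hs) = \<one>"
      by (auto simp: N_def)
    then have "generalized_torsion G g"
      using that A[OF that] unfolding generalized_torsion_def A_def by blast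
    then show False using assms that by (auto simp: A_def)
  qed
  have self: "g \<in> N g" if "g \<in> A" for g
    using A[OF that] unfolding N_def by (auto simp: conj_by_def intro!: exI[of _ "[\<one>]"])
  have mult: "x \<otimes> y \<in> N g" if g: "g \<in> A" and xy: "x \<in> N g" "y \<in> N g" for g x y
  proof -
    obtain hs ks where hs: "x = list_prod G (map (conj_by G g) hs)" "hs \<noteq> []" "set hs \<subseteq> carrier G"
      and ks: "y = list_prod G (map (conj_by G g) ks)" "ks \<noteq> []" "set ks \<subseteq> carrier G"
      using xy by (auto simp: N_def)
    have "set (map (conj_by G g) hs) \<subseteq> carrier G" "set (map (conj_by G g) ks) \<subseteq> carrier G"
      using hs ks conj_closed[OF g] by auto
    then have "x \<otimes> y = list_prod G (map (conj_by G g) (hs @ ks))"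
      using hs ks by (simp add: list_prod_append del: set_map)
    then show ?thesis using hs ks by (auto simp: N_def intro!: exI[of _ "hs @ ks"])
  qed
  have conj: "inv k \<otimes> x \<otimes> k \<in> N g" if g: "g \<in> A" and x: "x \<in> N g" and k: "k \<in> carrier G" for g x k
  proof -
    obtain hs where hs: "x = list_prod G (map (conj_by G g) hs)" "hs \<noteq> []" "set hs \<subseteq> carrier G"
      using x by (auto simp: N_def)
    have "set (map (conj_by G g) hs) \<subseteq> carrier G" using hs conj_closed[OF g] by auto
    then have "inv k \<otimes> x \<otimes> k =
        list_prod G (map (\<lambda>y. inv k \<otimes> y \<otimes> inv (inv k)) (map (conj_by G g) hs))"
      using list_prod_conj[of "map (conj_by G g) hs" "inv k"] k hs(1) by simp
    also have "map (\<lambda>y. inv k \<otimes> y \<otimes> inv (inv k)) (map (conj_by G g) hs) =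
        map (conj_by G g) (map (\<lambda>h. h \<otimes> k) hs)"
      using hs(3) k A[OF g] by (auto simp: conj_by_def m_assoc inv_mult_group)
    finally have "inv k \<otimes> x \<otimes> k = list_prod G (map (conj_by G g) (map (\<lambda>h. h \<otimes> k) hs))" .
    moreover have "set (map (\<lambda>h. h \<otimes> k) hs) \<subseteq> carrier G" "map (\<lambda>h. h \<otimes> k) hs \<noteq> []"
      using hs k by auto
    ultimately show ?thesis unfolding N_def by blast
  qed
  show ?thesis
  proof (intro exI[of _ F] conjI ballI)
    fix i P assume i: "i \<in> I" and "P \<in> F i"
    then obtain g where g: "g \<in> A" "P = N g \<inter> Gi i" by (auto simp: F_def)
    show "normal_subsemigroup G (Gi i) P"
      unfolding normal_subsemigroup_def g(2)
      using mult[OF g(1)] conj[OF g(1)] Gi_closed[OF i] by auto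
  next
    fix i assume i: "i \<in> I"
    show "Gi i - {\<one>} = \<Union>(F i)"
    proof
      show "Gi i - {\<one>} \<subseteq> \<Union>(F i)" using i self by (auto simp: F_def A_def)
      show "\<Union>(F i) \<subseteq> Gi i - {\<one>}" using one by (auto simp: F_def)
    qed
  next
    fix i j P assume ij: "i \<in> I" "j \<in> I" and "P \<in> F i"
    then obtain g where g: "g \<in> A" "P = N g \<inter> Gi i" by (auto simp: F_def)
    \<comment> \<open>Both traces on \<open>C\<close> equal \<open>N g \<inter> C\<close>, because
      \<open>C\<close> lies in every factor.\<close>
    have "P \<inter> C = (N g \<inter> Gi j) \<inter> C" using g(2) ij Gi_closed(4) by auto
    then show "\<exists>Q\<in>F j. P \<inter> C = Q \<inter> C" using g(1) by (auto simp: F_def)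
  qed
qed

end

theorem mainTheorem11:
  fixes G :: "('a, 'b) monoid_scheme" and I :: "'i set" and Gi :: "'i \<Rightarrow> 'a set" and C :: "'a set"
  assumes "amalgamated_free_product G I Gi C"
  shows "((\<forall>g \<in> (\<Union>i \<in> I. Gi i). \<not> generalized_torsion G g) \<longleftrightarrow>
           (\<exists>F :: 'i \<Rightarrow> 'a set set.
              (\<forall>i \<in> I. \<forall>P \<in> F i. normal_subsemigroup G (Gi i) P) \<and>
              (\<forall>i \<in> I. Gi i - {\<one>\<^bsub>G\<^esub>} = \<Union>(F i)) \<and>
              (\<forall>i \<in> I. \<forall>j \<in> I. \<forall>P \<in> F i. \<exists>Q \<in> F j. P \<inter> C = Q \<inter> C)))
       \<and> (((\<forall>i \<in> I. relatively_torsion_free G C (Gi i)) \<and>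
            (\<exists>F :: 'i \<Rightarrow> 'a set set.
              (\<forall>i \<in> I. \<forall>P \<in> F i. normal_subsemigroup G (Gi i) P) \<and>
              (\<forall>i \<in> I. Gi i - {\<one>\<^bsub>G\<^esub>} = \<Union>(F i)) \<and>
              (\<forall>i \<in> I. \<forall>j \<in> I. \<forall>P \<in> F i. \<exists>Q \<in> F j. P \<inter> C = Q \<inter> C)))
          \<longrightarrow> generalized_torsion_free G)"
proof -
  interpret group G using assms by (simp add: amalgamated_free_product_def)
  interpret amalgam G I Gi C by unfold_locales (rule assms)
  have torsion: "\<not> generalized_torsion G g"
    if F: "\<forall>i\<in>I. \<forall>P\<in>F i. normal_subsemigroup G (Gi i) P" "\<forall>i\<in>I. Gi i - {\<one>\<^bsub>G\<^esub>} = \<Union>(F i)"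
        "\<forall>i\<in>I. \<forall>j\<in>I. \<forall>P\<in>F i. \<exists>Q\<in>F j. P \<inter> C = Q \<inter> C"
      and g: "i \<in> I" "g \<in> Gi i" for F i g
  proof -
    have "g \<in> conjugates {g}" using subset_conjugates[of "{g}"] Gi_closed(1)[OF g] by simp
    then show ?thesis using no_generalized_torsion_in_factors[OF F g] by blast
  qed
  show ?thesis
  proof (intro conjI iffI impI, goal_cases)
    case 1
    then show ?case by (rule compatible_families_exist)
  next
    case 2
    then obtain F where F: "\<forall>i\<in>I. \<forall>P\<in>F i. normal_subsemigroup G (Gi i) P"
        "\<forall>i\<in>I. Gi i - {\<one>\<^bsub>G\<^esub>} = \<Union>(F i)"
        "\<forall>i\<in>I. \<forall>j\<in>I. \<forall>P\<in>F i. \<exists>Q\<in>F j. P \<inter> C = Q \<inter> C"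
      by (elim exE conjE) (rule that)
    show ?case using torsion[OF F] by blast
  next
    case 3
    then obtain F where F: "\<forall>i\<in>I. \<forall>P\<in>F i. normal_subsemigroup G (Gi i) P"
        "\<forall>i\<in>I. Gi i - {\<one>\<^bsub>G\<^esub>} = \<Union>(F i)"
        "\<forall>i\<in>I. \<forall>j\<in>I. \<forall>P\<in>F i. \<exists>Q\<in>F j. P \<inter> C = Q \<inter> C"
      by (elim exE conjE) (rule that)
    show ?case using generalized_torsion_free_amalgam[OF F] 3 by (elim conjE)
  qed
qed

end
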